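(* Let $\mathfrak k$ be a field, $n\ge 2$ an integer, and let $q\in\mathfrak k^*$ satisfy $[k]_q\ne 0$ for $2\le k\le n$. Then in the Hecke algebra $H_n(q)$ the symmetrizer $S_n$ is expressed in terms of the additive 1-shuffle $\mathrm{sh}_{1,n-1}$ alone by $$S_n=\frac{q^{-\frac{(n-1)(3n-4)}{2}}}{[n]_q!}\;\prod_{j=0}^{n-2}\bigl(\mathrm{sh}_{1,n-1}-q^{j-1}[j]_q\bigr).$$
   Context: Notation: $[j]_q=(q^j-q^{-j})/(q-q^{-1})=q^{j-1}+q^{j-3}+\cdots+q^{1-j}$, $[0]_q=0$, $[n]_q!=[1]_q[2]_q\cdots[n]_q$. $H_n(q)$ is the quotient of the group algebra over $\mathfrak k$ of the braid group $B_n$ (generators $\sigma_1,\dots,\sigma_{n-1}$; relations $\sigma_i\sigma_j\sigma_i=\sigma_j\sigma_i\sigma_j$ for $|i-j|=1$, $\sigma_i\sigma_j=\sigma_j\sigma_i$ for $|i-j|>1$) by $\sigma_i^2=(q-q^{-1})\sigma_i+1$. The additive 1-shuffle (the braid shuffle element built from $q\sigma_1,\dots,q\sigma_{n-1}$) is $$\mathrm{sh}_{1,n-1}=1+q\sigma_{n-1}+q^2\sigma_{n-2}\sigma_{n-1}+\cdots+q^{n-1}\sigma_1\sigma_2\cdots\sigma_{n-1};$$ scalars are understood as multiples of the identity. The symmetrizer $S_n$ is the unique non-zero element of $H_n(q)$ with $\sigma_iS_n=S_n\sigma_i=qS_n$ for $i=1,\dots,n-1$ and $S_n^2=S_n$.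 *)

theory Defs
  imports "HOL-Algebra.QuotRing"
begin

section \<open>Quantum integers\<close>

text \<open>The Laurent polynomial form of \<open>[j]\<^sub>q\<close>, which also makes sense when \<open>q = inverse q\<close>;
  see \<open>qint_eq_quotient\<close> for the quotient form.\<close>

definition qint :: "'k::field \<Rightarrow> nat \<Rightarrow> 'k" where
  "qint q j = (\<Sum>i<j. q powi (int j - 1 - 2 * int i))"

definition qfact :: "'k::field \<Rightarrow> nat \<Rightarrow> 'k" where
  "qfact q n = (\<Prod>j=1..n. qint q j)"

lemma qint_0 [simp]: "qint q 0 = 0"
  by (simp add: qint_def)

lemma qint_eq_quotient:
  fixes q :: "'k::field"
  assumes "q \<noteq> 0" and "q \<noteq> inverse q"
  shows "qint q j = (q ^ j - inverse q ^ j) / (q - inverse q)"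
proof -
  let ?t = "\<lambda>i. q powi (int j - 2 * int i)"
  have "(q - inverse q) * qint q j = (\<Sum>i<j. ?t i - ?t (Suc i))"
    unfolding qint_def sum_distrib_left
  proof (rule sum.cong)
    fix i
    have "?t i = q * q powi (int j - 1 - 2 * int i)"
      using power_int_add[of q 1 "int j - 1 - 2 * int i"] assms(1) by simp
    moreover have "?t (Suc i) = inverse q * q powi (int j - 1 - 2 * int i)"
      using power_int_add[of q "-1" "int j - 1 - 2 * int i"] assms(1)
      by (simp add: algebra_simps)
    ultimately show "(q - inverse q) * q powi (int j - 1 - 2 * int i) = ?t i - ?t (Suc i)"
      by (simp add: algebra_simps)
  qed simp
  also have "\<dots> = ?t 0 - ?t j"
    by (rule sum_lessThan_telescope')
  also have "\<dots> = q ^ j - inverse q ^ j"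
    by (simp add: power_int_minus power_inverse)
  finally show ?thesis
    using assms(2) by (simp add: field_simps)
qed

section \<open>The braid group\<close>

text \<open>The letter \<open>(i, True)\<close> stands for \<open>\<sigma>\<^sub>i\<close> and \<open>(i, False)\<close> for its inverse.\<close>

type_synonym braid_word = "(nat \<times> bool) list"

definition braid_words :: "nat \<Rightarrow> braid_word set" where
  "braid_words n = lists ({1..<n} \<times> UNIV)"

inductive braid_eq :: "nat \<Rightarrow> braid_word \<Rightarrow> braid_word \<Rightarrow> bool" for n where
  braid_eq_refl: "w \<in> braid_words n \<Longrightarrow> braid_eq n w w"
| braid_eq_sym: "braid_eq n v w \<Longrightarrow> braid_eq n w v"
| braid_eq_trans: "braid_eq n u v \<Longrightarrow> braid_eq n v w \<Longrightarrow> braid_eq n u w"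
| braid_eq_append: "braid_eq n u u' \<Longrightarrow> braid_eq n v v' \<Longrightarrow> braid_eq n (u @ v) (u' @ v')"
| braid_eq_cancel: "i \<in> {1..<n} \<Longrightarrow> braid_eq n [(i, b), (i, \<not> b)] []"
| braid_eq_braid: "i \<in> {1..<n} \<Longrightarrow> j \<in> {1..<n} \<Longrightarrow> \<bar>int i - int j\<bar> = 1 \<Longrightarrow>
    braid_eq n [(i, True), (j, True), (i, True)] [(j, True), (i, True), (j, True)]"
| braid_eq_commute: "i \<in> {1..<n} \<Longrightarrow> j \<in> {1..<n} \<Longrightarrow> \<bar>int i - int j\<bar> > 1 \<Longrightarrow>
    braid_eq n [(i, True), (j, True)] [(j, True), (i, True)]"

definition braid_class :: "nat \<Rightarrow> braid_word \<Rightarrow> braid_word set" where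
  "braid_class n w = {v. braid_eq n w v}"

definition braid_group :: "nat \<Rightarrow> braid_word set monoid" where
  "braid_group n =
    \<lparr>carrier = braid_class n ` braid_words n,
     mult = (\<lambda>A B. {w. \<exists>u\<in>A. \<exists>v\<in>B. braid_eq n (u @ v) w}),
     one = braid_class n []\<rparr>"

definition braid_gen :: "nat \<Rightarrow> nat \<Rightarrow> braid_word set" where
  "braid_gen n i = braid_class n [(i, True)]"

lemma braid_eq_words: "braid_eq n u v \<Longrightarrow> u \<in> braid_words n \<and> v \<in> braid_words n"
  by (induction rule: braid_eq.induct) (auto simp: braid_words_def)

lemma braid_class_eq_iff:
  assumes "u \<in> braid_words n"
  shows "braid_class n u = braid_class n v \<longleftrightarrow> braid_eq n u v"
  using assms braid_eq_refl[of u n]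
  by (auto simp: braid_class_def intro: braid_eq_trans braid_eq_sym)

lemma braid_class_mult:
  assumes "u \<in> braid_words n" "v \<in> braid_words n"
  shows "braid_class n u \<otimes>\<^bsub>braid_group n\<^esub> braid_class n v = braid_class n (u @ v)"
  using braid_eq_refl[OF assms(1)] braid_eq_refl[OF assms(2)]
  by (auto simp: braid_class_def braid_group_def intro: braid_eq_trans braid_eq_append)

lemma carrier_braid_group: "carrier (braid_group n) = braid_class n ` braid_words n"
  by (simp add: braid_group_def)

lemma one_braid_group: "\<one>\<^bsub>braid_group n\<^esub> = braid_class n []"
  by (simp add: braid_group_def)

lemma braid_words_Nil: "[] \<in> braid_words n"
  by (simp add: braid_words_def)

lemma braid_words_append: "u @ v \<in> braid_words n \<longleftrightarrow> u \<in> braid_words n \<and> v \<in> braid_words n"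
  by (auto simp: braid_words_def)

lemma braid_word_left_inverse:
  "w \<in> braid_words n \<Longrightarrow> \<exists>v \<in> braid_words n. braid_eq n (v @ w) []"
proof (induction w)
  case Nil
  then show ?case
    by (intro bexI[of _ "[]"]) (auto intro: braid_eq_refl simp: braid_words_Nil)
next
  case (Cons x w)
  obtain i b where x: "x = (i, b)" by (cases x)
  have i: "i \<in> {1..<n}" and w: "w \<in> braid_words n"
    using Cons.prems by (auto simp: x braid_words_def)
  obtain v where v: "v \<in> braid_words n" "braid_eq n (v @ w) []"
    using Cons.IH[OF w] by blast
  have "braid_eq n ([(i, \<not> b), (i, b)] @ w) ([] @ w)"
    using braid_eq_append[OF braid_eq_cancel[OF i, of "\<not> b"] braid_eq_refl[OF w]] by simp
  then have "braid_eq n (v @ [(i, \<not> b), (i, b)] @ w) (v @ w)"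
    using braid_eq_append[OF braid_eq_refl[OF v(1)]] by auto
  then have "braid_eq n ((v @ [(i, \<not> b)]) @ x # w) []"
    using v(2) x by (auto intro: braid_eq_trans)
  moreover have "v @ [(i, \<not> b)] \<in> braid_words n"
    using v(1) i by (auto simp: braid_words_def)
  ultimately show ?case by blast
qed

lemma group_braid_group: "group (braid_group n)"
proof (rule groupI)
  show "\<one>\<^bsub>braid_group n\<^esub> \<in> carrier (braid_group n)"
    by (auto simp: carrier_braid_group one_braid_group braid_words_Nil)
  fix x y z
  assume x: "x \<in> carrier (braid_group n)"
  then obtain u where u: "x = braid_class n u" "u \<in> braid_words n"
    by (auto simp: carrier_braid_group)
  show "\<one>\<^bsub>braid_group n\<^esub> \<otimes>\<^bsub>braid_group n\<^esub> x = x"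
    by (simp add: u one_braid_group braid_class_mult braid_words_Nil)
  obtain v where "v \<in> braid_words n" "braid_eq n (v @ u) []"
    using braid_word_left_inverse[OF u(2)] by blast
  then show "\<exists>y\<in>carrier (braid_group n). y \<otimes>\<^bsub>braid_group n\<^esub> x = \<one>\<^bsub>braid_group n\<^esub>"
    by (intro bexI[of _ "braid_class n v"])
      (auto simp: carrier_braid_group one_braid_group braid_class_mult braid_class_eq_iff u
        braid_words_append)
  assume "y \<in> carrier (braid_group n)"
  then obtain v where v: "y = braid_class n v" "v \<in> braid_words n"
    by (auto simp: carrier_braid_group)
  show "x \<otimes>\<^bsub>braid_group n\<^esub> y \<in> carrier (braid_group n)"
    by (auto simp: u v carrier_braid_group braid_class_mult braid_words_append)
  assume "z \<in> carrier (braid_group n)"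
  then obtain w where w: "z = braid_class n w" "w \<in> braid_words n"
    by (auto simp: carrier_braid_group)
  show "x \<otimes>\<^bsub>braid_group n\<^esub> y \<otimes>\<^bsub>braid_group n\<^esub> z = x \<otimes>\<^bsub>braid_group n\<^esub> (y \<otimes>\<^bsub>braid_group n\<^esub> z)"
    by (simp add: u v w braid_class_mult braid_words_append)
qed

lemma braid_gen_closed: "i \<in> {1..<n} \<Longrightarrow> braid_gen n i \<in> carrier (braid_group n)"
  by (auto simp: braid_gen_def carrier_braid_group braid_words_def)

section \<open>The group algebra\<close>

definition supp :: "('g \<Rightarrow> 'k::zero) \<Rightarrow> 'g set" where
  "supp f = {x. f x \<noteq> 0}"

definition single :: "'g \<Rightarrow> 'k::zero \<Rightarrow> 'g \<Rightarrow> 'k" where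
  "single g c = (\<lambda>x. if x = g then c else 0)"

definition group_algebra :: "('g, 'm) monoid_scheme \<Rightarrow> ('g \<Rightarrow> 'k::field) ring" where
  "group_algebra G =
    \<lparr>carrier = {f. finite (supp f) \<and> supp f \<subseteq> carrier G},
     mult = (\<lambda>f g x. \<Sum>(y, z) \<in> supp f \<times> supp g. if y \<otimes>\<^bsub>G\<^esub> z = x then f y * g z else 0),
     one = single \<one>\<^bsub>G\<^esub> 1,
     zero = (\<lambda>x. 0),
     add = (\<lambda>f g x. f x + g x)\<rparr>"

lemma group_algebra_mult_superset:
  fixes f g :: "'g \<Rightarrow> 'k::field"
  assumes "finite A" "finite B" "supp f \<subseteq> A" "supp g \<subseteq> B"
  shows "(f \<otimes>\<^bsub>group_algebra G\<^esub> g) x = (\<Sum>y\<in>A. \<Sum>z\<in>B. if y \<otimes>\<^bsub>G\<^esub> z = x then f y * g z else 0)"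
proof -
  have "(f \<otimes>\<^bsub>group_algebra G\<^esub> g) x =
      (\<Sum>(y, z) \<in> A \<times> B. if y \<otimes>\<^bsub>G\<^esub> z = x then f y * g z else 0)"
    unfolding group_algebra_def
    by (simp, rule sum.mono_neutral_left) (use assms in \<open>auto simp: supp_def split: if_splits\<close>)
  then show ?thesis
    by (simp add: sum.cartesian_product)
qed

lemma supp_group_algebra_mult:
  "supp (f \<otimes>\<^bsub>group_algebra G\<^esub> g) \<subseteq> (\<lambda>(y, z). y \<otimes>\<^bsub>G\<^esub> z) ` (supp f \<times> supp g)"
proof
  fix x assume "x \<in> supp (f \<otimes>\<^bsub>group_algebra G\<^esub> g)"
  then have "(\<Sum>(y, z) \<in> supp f \<times> supp g. if y \<otimes>\<^bsub>G\<^esub> z = x then f y * g z else 0) \<noteq> 0"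
    by (simp add: supp_def group_algebra_def)
  then obtain p where "p \<in> supp f \<times> supp g"
    "(case p of (y, z) \<Rightarrow> if y \<otimes>\<^bsub>G\<^esub> z = x then f y * g z else 0) \<noteq> 0"
    by (meson sum.not_neutral_contains_not_neutral)
  then show "x \<in> (\<lambda>(y, z). y \<otimes>\<^bsub>G\<^esub> z) ` (supp f \<times> supp g)"
    by (force split: if_splits)
qed

lemma single_closed: "g \<in> carrier G \<Longrightarrow> single g c \<in> carrier (group_algebra G)"
proof -
  have "supp (single g c) \<subseteq> {g}"
    by (auto simp: supp_def single_def)
  then show "g \<in> carrier G \<Longrightarrow> single g c \<in> carrier (group_algebra G)"
    by (auto simp: group_algebra_def intro: finite_subset)
qed

lemma ring_group_algebra:
  assumes "monoid G"
  shows "ring (group_algebra G :: ('g \<Rightarrow> 'k::field) ring)" (is "ring ?R")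
proof -
  interpret monoid G by fact
  have swap3: "(\<Sum>y\<in>Y. \<Sum>a\<in>A. \<Sum>b\<in>B. F y a b) = (\<Sum>a\<in>A. \<Sum>b\<in>B. \<Sum>y\<in>Y. F y a b)"
    for Y :: "'g set" and A B :: "'g set" and F :: "'g \<Rightarrow> 'g \<Rightarrow> 'g \<Rightarrow> 'k"
    by (rule trans[OF sum.swap]) (intro sum.cong refl sum.swap)
  have swap4: "(\<Sum>y\<in>Y. \<Sum>c\<in>C. \<Sum>a\<in>A. \<Sum>b\<in>B. F y c a b) =
      (\<Sum>a\<in>A. \<Sum>b\<in>B. \<Sum>c\<in>C. \<Sum>y\<in>Y. F y c a b)"
    for Y :: "'g set" and A B C :: "'g set" and F :: "'g \<Rightarrow> 'g \<Rightarrow> 'g \<Rightarrow> 'g \<Rightarrow> 'k"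
  proof -
    have "(\<Sum>y\<in>Y. \<Sum>c\<in>C. \<Sum>a\<in>A. \<Sum>b\<in>B. F y c a b) =
        (\<Sum>a\<in>A. \<Sum>b\<in>B. \<Sum>y\<in>Y. \<Sum>c\<in>C. F y c a b)"
      by (rule trans[OF sum.cong[OF refl swap3] swap3])
    also have "\<dots> = (\<Sum>a\<in>A. \<Sum>b\<in>B. \<Sum>c\<in>C. \<Sum>y\<in>Y. F y c a b)"
      by (intro sum.cong refl sum.swap)
    finally show ?thesis .
  qed
  have add: "(f \<oplus>\<^bsub>?R\<^esub> g) x = f x + g x" for f g x
    by (simp add: group_algebra_def)
  have mem: "f \<in> carrier ?R \<longleftrightarrow> finite (supp f) \<and> supp f \<subseteq> carrier G" for f :: "'g \<Rightarrow> 'k"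
    by (simp add: group_algebra_def)
  have supp_add: "supp (f \<oplus>\<^bsub>?R\<^esub> g) \<subseteq> supp f \<union> supp g" for f g
    by (auto simp: supp_def add)
  have supp_one: "supp (\<one>\<^bsub>?R\<^esub>) = {\<one>\<^bsub>G\<^esub>}"
    by (auto simp: supp_def group_algebra_def single_def)
  have one: "(\<one>\<^bsub>?R\<^esub>) x = (if x = \<one>\<^bsub>G\<^esub> then 1 else 0)" for x
    by (simp add: group_algebra_def single_def)
  have abel: "abelian_group ?R"
  proof (rule abelian_groupI)
    fix f g assume "f \<in> carrier ?R" "g \<in> carrier ?R"
    then show "f \<oplus>\<^bsub>?R\<^esub> g \<in> carrier ?R"
      using supp_add[of f g] unfolding mem by (meson finite_Un finite_subset le_sup_iff order_trans)
  next
    fix f assume f: "f \<in> carrier ?R"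
    show "\<exists>g\<in>carrier ?R. g \<oplus>\<^bsub>?R\<^esub> f = \<zero>\<^bsub>?R\<^esub>"
      using f by (intro bexI[of _ "\<lambda>x. - f x"]) (auto simp: group_algebra_def supp_def)
  qed (auto simp: group_algebra_def supp_def algebra_simps)
  have closed: "f \<otimes>\<^bsub>?R\<^esub> g \<in> carrier ?R" if "f \<in> carrier ?R" "g \<in> carrier ?R" for f g
  proof -
    have "finite ((\<lambda>(y, z). y \<otimes>\<^bsub>G\<^esub> z) ` (supp f \<times> supp g))"
      using that by (auto simp: mem)
    moreover have "(\<lambda>(y, z). y \<otimes>\<^bsub>G\<^esub> z) ` (supp f \<times> supp g) \<subseteq> carrier G"
      using that by (auto simp: mem)
    ultimately show ?thesis
      using supp_group_algebra_mult[where G = G and f = f and g = g] unfolding mem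
      by (meson finite_subset order_trans)
  qed
  have assoc: "f \<otimes>\<^bsub>?R\<^esub> g \<otimes>\<^bsub>?R\<^esub> h = f \<otimes>\<^bsub>?R\<^esub> (g \<otimes>\<^bsub>?R\<^esub> h)"
    if f: "f \<in> carrier ?R" and g: "g \<in> carrier ?R" and h: "h \<in> carrier ?R" for f g h
  proof
    fix x
    let ?A = "supp f" and ?B = "supp g" and ?C = "supp h"
    let ?AB = "(\<lambda>(y, z). y \<otimes>\<^bsub>G\<^esub> z) ` (?A \<times> ?B)" and ?BC = "(\<lambda>(y, z). y \<otimes>\<^bsub>G\<^esub> z) ` (?B \<times> ?C)"
    have fin: "finite ?A" "finite ?B" "finite ?C" "finite ?AB" "finite ?BC"
      and sub: "?A \<subseteq> carrier G" "?B \<subseteq> carrier G" "?C \<subseteq> carrier G"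
      using f g h by (auto simp: mem)
    have fg: "(f \<otimes>\<^bsub>?R\<^esub> g) y = (\<Sum>a\<in>?A. \<Sum>b\<in>?B. if a \<otimes>\<^bsub>G\<^esub> b = y then f a * g b else 0)" for y
      by (rule group_algebra_mult_superset) (use fin in auto)
    have gh: "(g \<otimes>\<^bsub>?R\<^esub> h) y = (\<Sum>b\<in>?B. \<Sum>c\<in>?C. if b \<otimes>\<^bsub>G\<^esub> c = y then g b * h c else 0)" for y
      by (rule group_algebra_mult_superset) (use fin in auto)
    let ?S = "\<Sum>a\<in>?A. \<Sum>b\<in>?B. \<Sum>c\<in>?C. if a \<otimes>\<^bsub>G\<^esub> (b \<otimes>\<^bsub>G\<^esub> c) = x then f a * g b * h c else 0"
    have "(f \<otimes>\<^bsub>?R\<^esub> g \<otimes>\<^bsub>?R\<^esub> h) x =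
        (\<Sum>y\<in>?AB. \<Sum>c\<in>?C. if y \<otimes>\<^bsub>G\<^esub> c = x then (f \<otimes>\<^bsub>?R\<^esub> g) y * h c else 0)"
      by (rule group_algebra_mult_superset[OF _ _ supp_group_algebra_mult order_refl]) (use fin in auto)
    also have "\<dots> = (\<Sum>y\<in>?AB. \<Sum>c\<in>?C. \<Sum>a\<in>?A. \<Sum>b\<in>?B.
        if a \<otimes>\<^bsub>G\<^esub> b = y then (if a \<otimes>\<^bsub>G\<^esub> b \<otimes>\<^bsub>G\<^esub> c = x then f a * g b * h c else 0) else 0)"
      unfolding fg sum_distrib_right
      by (intro sum.cong refl) (auto simp: sum_distrib_right intro!: sum.cong sum.neutral)
    also have "\<dots> = (\<Sum>a\<in>?A. \<Sum>b\<in>?B. \<Sum>c\<in>?C. \<Sum>y\<in>?AB.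
        if a \<otimes>\<^bsub>G\<^esub> b = y then (if a \<otimes>\<^bsub>G\<^esub> b \<otimes>\<^bsub>G\<^esub> c = x then f a * g b * h c else 0) else 0)"
      by (rule swap4)
    also have "\<dots> = ?S"
      using fin sub by (intro sum.cong refl) (force simp: m_assoc subset_iff)
    finally have 1: "(f \<otimes>\<^bsub>?R\<^esub> g \<otimes>\<^bsub>?R\<^esub> h) x = ?S" .
    have "(f \<otimes>\<^bsub>?R\<^esub> (g \<otimes>\<^bsub>?R\<^esub> h)) x =
        (\<Sum>a\<in>?A. \<Sum>y\<in>?BC. if a \<otimes>\<^bsub>G\<^esub> y = x then f a * (g \<otimes>\<^bsub>?R\<^esub> h) y else 0)"
      by (rule group_algebra_mult_superset[OF _ _ order_refl supp_group_algebra_mult]) (use fin in auto)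
    also have "\<dots> = (\<Sum>a\<in>?A. \<Sum>y\<in>?BC. \<Sum>b\<in>?B. \<Sum>c\<in>?C.
        if b \<otimes>\<^bsub>G\<^esub> c = y then (if a \<otimes>\<^bsub>G\<^esub> (b \<otimes>\<^bsub>G\<^esub> c) = x then f a * g b * h c else 0) else 0)"
      unfolding gh
      by (intro sum.cong refl) (auto simp: sum_distrib_left mult.assoc intro!: sum.cong sum.neutral)
    also have "\<dots> = (\<Sum>a\<in>?A. \<Sum>b\<in>?B. \<Sum>c\<in>?C. \<Sum>y\<in>?BC.
        if b \<otimes>\<^bsub>G\<^esub> c = y then (if a \<otimes>\<^bsub>G\<^esub> (b \<otimes>\<^bsub>G\<^esub> c) = x then f a * g b * h c else 0) else 0)"
      by (intro sum.cong refl swap3)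
    also have "\<dots> = ?S"
      using fin by (intro sum.cong refl) force
    finally show "(f \<otimes>\<^bsub>?R\<^esub> g \<otimes>\<^bsub>?R\<^esub> h) x = (f \<otimes>\<^bsub>?R\<^esub> (g \<otimes>\<^bsub>?R\<^esub> h)) x"
      using 1 by simp
  qed
  have mon: "monoid ?R"
  proof (rule monoidI)
    show "\<one>\<^bsub>?R\<^esub> \<in> carrier ?R"
      by (simp add: mem supp_one)
  next
    fix f assume f: "f \<in> carrier ?R"
    then have fin: "finite (supp f)" and sub: "\<And>y. y \<in> supp f \<Longrightarrow> y \<in> carrier G"
      by (auto simp: mem)
    show "\<one>\<^bsub>?R\<^esub> \<otimes>\<^bsub>?R\<^esub> f = f"
    proof
      fix x
      have "(\<one>\<^bsub>?R\<^esub> \<otimes>\<^bsub>?R\<^esub> f) x =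
          (\<Sum>y\<in>{\<one>\<^bsub>G\<^esub>}. \<Sum>z\<in>supp f. if y \<otimes>\<^bsub>G\<^esub> z = x then (\<one>\<^bsub>?R\<^esub>) y * f z else 0)"
        by (rule group_algebra_mult_superset) (use fin supp_one in auto)
      also have "\<dots> = (\<Sum>z\<in>supp f. if z = x then f z else 0)"
        by (simp, intro sum.cong) (auto simp: sub one)
      also have "\<dots> = f x"
        using fin by (simp add: supp_def)
      finally show "(\<one>\<^bsub>?R\<^esub> \<otimes>\<^bsub>?R\<^esub> f) x = f x" .
    qed
    show "f \<otimes>\<^bsub>?R\<^esub> \<one>\<^bsub>?R\<^esub> = f"
    proof
      fix x
      have "(f \<otimes>\<^bsub>?R\<^esub> \<one>\<^bsub>?R\<^esub>) x =
          (\<Sum>z\<in>supp f. \<Sum>y\<in>{\<one>\<^bsub>G\<^esub>}. if z \<otimes>\<^bsub>G\<^esub> y = x then f z * (\<one>\<^bsub>?R\<^esub>) y else 0)"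
        by (rule group_algebra_mult_superset) (use fin supp_one in auto)
      also have "\<dots> = (\<Sum>z\<in>supp f. if z = x then f z else 0)"
        by (simp, intro sum.cong) (auto simp: sub one)
      also have "\<dots> = f x"
        using fin by (simp add: supp_def)
      finally show "(f \<otimes>\<^bsub>?R\<^esub> \<one>\<^bsub>?R\<^esub>) x = f x" .
    qed
  qed (use closed assoc in auto)
  show ?thesis
  proof (rule ringI[OF abel mon])
    fix f g h assume f: "f \<in> carrier ?R" and g: "g \<in> carrier ?R" and h: "h \<in> carrier ?R"
    have fin: "finite (supp f \<union> supp g)" "finite (supp h)"
      using f g h by (auto simp: mem)
    show "(f \<oplus>\<^bsub>?R\<^esub> g) \<otimes>\<^bsub>?R\<^esub> h = f \<otimes>\<^bsub>?R\<^esub> h \<oplus>\<^bsub>?R\<^esub> g \<otimes>\<^bsub>?R\<^esub> h"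
    proof
      fix x
      have *: "(u \<otimes>\<^bsub>?R\<^esub> h) x = (\<Sum>y\<in>supp f \<union> supp g. \<Sum>z\<in>supp h. if y \<otimes>\<^bsub>G\<^esub> z = x then u y * h z else 0)"
        if "supp u \<subseteq> supp f \<union> supp g" for u
        by (rule group_algebra_mult_superset) (use fin that in auto)
      show "((f \<oplus>\<^bsub>?R\<^esub> g) \<otimes>\<^bsub>?R\<^esub> h) x = (f \<otimes>\<^bsub>?R\<^esub> h \<oplus>\<^bsub>?R\<^esub> g \<otimes>\<^bsub>?R\<^esub> h) x"
        unfolding add *[OF supp_add] *[OF Un_upper1] *[OF Un_upper2] sum.distrib[symmetric]
        by (intro sum.cong refl) (simp add: algebra_simps)
    qed
    show "h \<otimes>\<^bsub>?R\<^esub> (f \<oplus>\<^bsub>?R\<^esub> g) = h \<otimes>\<^bsub>?R\<^esub> f \<oplus>\<^bsub>?R\<^esub> h \<otimes>\<^bsub>?R\<^esub> g"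
    proof
      fix x
      have *: "(h \<otimes>\<^bsub>?R\<^esub> u) x = (\<Sum>z\<in>supp h. \<Sum>y\<in>supp f \<union> supp g. if z \<otimes>\<^bsub>G\<^esub> y = x then h z * u y else 0)"
        if "supp u \<subseteq> supp f \<union> supp g" for u
        by (rule group_algebra_mult_superset) (use fin that in auto)
      show "(h \<otimes>\<^bsub>?R\<^esub> (f \<oplus>\<^bsub>?R\<^esub> g)) x = (h \<otimes>\<^bsub>?R\<^esub> f \<oplus>\<^bsub>?R\<^esub> h \<otimes>\<^bsub>?R\<^esub> g) x"
        unfolding add *[OF supp_add] *[OF Un_upper1] *[OF Un_upper2] sum.distrib[symmetric]
        by (intro sum.cong refl) (simp add: algebra_simps)
    qed
  qed
qed

section \<open>The Hecke algebra\<close>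

abbreviation braid_algebra :: "nat \<Rightarrow> (braid_word set \<Rightarrow> 'k::field) ring" where
  "braid_algebra n \<equiv> group_algebra (braid_group n)"

definition hecke_relator :: "nat \<Rightarrow> 'k::field \<Rightarrow> nat \<Rightarrow> braid_word set \<Rightarrow> 'k" where
  "hecke_relator n q i =
    single (braid_gen n i) 1 \<otimes>\<^bsub>braid_algebra n\<^esub> single (braid_gen n i) 1
      \<ominus>\<^bsub>braid_algebra n\<^esub> (single (braid_gen n i) (q - inverse q) \<oplus>\<^bsub>braid_algebra n\<^esub> \<one>\<^bsub>braid_algebra n\<^esub>)"

definition hecke_ideal :: "nat \<Rightarrow> 'k::field \<Rightarrow> (braid_word set \<Rightarrow> 'k) set" where
  "hecke_ideal n q = Idl\<^bsub>braid_algebra n\<^esub> (hecke_relator n q ` {1..<n})"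

definition hecke_algebra :: "nat \<Rightarrow> 'k::field \<Rightarrow> (braid_word set \<Rightarrow> 'k) set ring" where
  "hecke_algebra n q = braid_algebra n Quot hecke_ideal n q"

definition hecke_scalar :: "nat \<Rightarrow> 'k::field \<Rightarrow> 'k \<Rightarrow> (braid_word set \<Rightarrow> 'k) set" where
  "hecke_scalar n q c = hecke_ideal n q +>\<^bsub>braid_algebra n\<^esub> single \<one>\<^bsub>braid_group n\<^esub> c"

definition hecke_gen :: "nat \<Rightarrow> 'k::field \<Rightarrow> nat \<Rightarrow> (braid_word set \<Rightarrow> 'k) set" where
  "hecke_gen n q i = hecke_ideal n q +>\<^bsub>braid_algebra n\<^esub> single (braid_gen n i) 1"

lemma ring_braid_algebra: "ring (braid_algebra n)"
  by (intro ring_group_algebra group.is_monoid group_braid_group)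

lemma ideal_hecke_ideal: "ideal (hecke_ideal n q) (braid_algebra n)"
proof -
  interpret ring "braid_algebra n :: (braid_word set \<Rightarrow> 'a) ring"
    by (rule ring_braid_algebra)
  show ?thesis
    unfolding hecke_ideal_def
    by (rule genideal_ideal) (auto simp: hecke_relator_def single_closed braid_gen_closed)
qed

lemma ring_hecke_algebra: "ring (hecke_algebra n q)"
  unfolding hecke_algebra_def by (rule ideal.quotient_is_ring[OF ideal_hecke_ideal])

section \<open>Shuffle and symmetrizer\<close>

definition ring_prod_list :: "('a, 'm) ring_scheme \<Rightarrow> 'a list \<Rightarrow> 'a" where
  "ring_prod_list R xs = foldr (mult R) xs (one R)"

text \<open>The \<open>k\<close>-th summand is \<open>q^k \<sigma>\<^bsub>n-k\<^esub> \<sigma>\<^bsub>n-k+1\<^esub> \<dots> \<sigma>\<^bsub>n-1\<^esub>\<close>.\<close>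

definition one_shuffle :: "nat \<Rightarrow> 'k::field \<Rightarrow> (braid_word set \<Rightarrow> 'k) set" where
  "one_shuffle n q =
    (\<Oplus>\<^bsub>hecke_algebra n q\<^esub> k \<in> {0..<n}.
      hecke_scalar n q (q ^ k) \<otimes>\<^bsub>hecke_algebra n q\<^esub>
        ring_prod_list (hecke_algebra n q) (map (hecke_gen n q) [n - k..<n]))"

definition is_symmetrizer :: "nat \<Rightarrow> 'k::field \<Rightarrow> (braid_word set \<Rightarrow> 'k) set \<Rightarrow> bool" where
  "is_symmetrizer n q S \<longleftrightarrow>
    S \<in> carrier (hecke_algebra n q) \<and> S \<noteq> \<zero>\<^bsub>hecke_algebra n q\<^esub> \<and>
    (\<forall>i\<in>{1..<n}.
      hecke_gen n q i \<otimes>\<^bsub>hecke_algebra n q\<^esub> S = hecke_scalar n q q \<otimes>\<^bsub>hecke_algebra n q\<^esub> S \<and>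
      S \<otimes>\<^bsub>hecke_algebra n q\<^esub> hecke_gen n q i = hecke_scalar n q q \<otimes>\<^bsub>hecke_algebra n q\<^esub> S) \<and>
    S \<otimes>\<^bsub>hecke_algebra n q\<^esub> S = S"

definition symmetrizer :: "nat \<Rightarrow> 'k::field \<Rightarrow> (braid_word set \<Rightarrow> 'k) set" where
  "symmetrizer n q = (THE S. is_symmetrizer n q S)"

end

theory Submission
  imports Defs
begin

text \<open>
  Put \<open>Q = q\<^sup>2\<close> and \<open>t\<^sub>i = q \<sigma>\<^sub>i\<close>, so that \<open>(t\<^sub>i - Q) (t\<^sub>i + 1) = 0\<close>. The shuffles \<open>s\<^sub>m\<close> on \<open>m\<close> strands
  satisfy \<open>s\<^bsub>m+1\<^esub> = 1 + s\<^sub>m t\<^sub>m\<close>. By induction \<open>s\<^bsub>m+1\<^esub> s\<^sub>m (t\<^sub>m - Q) = 0\<close>, which gives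
  \<open>s\<^bsub>m+1\<^esub>\<^sup>2 = s\<^bsub>m+1\<^esub> (1 + Q s\<^sub>m)\<close>. With \<open>B\<^sub>k = s\<^sub>n s\<^bsub>n-1\<^esub> \<dots> s\<^bsub>n-k+1\<^esub>\<close> this yields
  \<open>(s\<^sub>n - [k]\<^sub>Q) B\<^sub>k = Q^k B\<^bsub>k+1\<^esub>\<close> for \<open>[k]\<^sub>Q = 1 + Q + \<dots> + Q^(k-1) = q^(k-1) [k]\<^sub>q\<close>, so the product in
  the theorem is a power of \<open>Q\<close> times \<open>X = s\<^sub>n s\<^bsub>n-1\<^esub> \<dots> s\<^sub>1\<close>. The same relation gives \<open>X t\<^sub>i = Q X\<close>, and
  since \<open>X\<close> is also the mirror image of itself, \<open>t\<^sub>i X = Q X\<close>. The normalisation is the value of the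
  product under \<open>\<sigma>\<^sub>i \<mapsto> q\<close>; this character also shows that \<open>X\<close> is non-zero.
\<close>

section \<open>Quantum integers\<close>

definition qbracket :: "'k::field \<Rightarrow> nat \<Rightarrow> 'k" where
  "qbracket Q k = (\<Sum>i<k. Q ^ i)"

lemma qbracket_0 [simp]: "qbracket Q 0 = 0"
  and qbracket_Suc: "qbracket Q (Suc k) = qbracket Q k + Q ^ k"
  by (simp_all add: qbracket_def)

text \<open>Splitting off the lowest power instead of the highest yields the recursion that
  \<open>shuf (Suc m) = \<one> \<oplus> shuf m \<otimes> t (Suc m)\<close> satisfies once
  \<open>t (Suc m)\<close> acts as \<open>Q\<close>.\<close>

lemma qbracket_Suc': "qbracket Q (Suc k) = 1 + Q * qbracket Q k"
  by (simp add: qbracket_def sum.lessThan_Suc_shift sum_distrib_left del: sum.lessThan_Suc)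

text \<open>The exponents (j - 1) + (j - 1 - 2i) = 2 (j - 1 - i) are the even numbers below 2j in
  reverse order. This turns the constants subtracted in the theorem into sums of powers of
  \<open>q ^ 2\<close>; for j = 0 the negative exponent is harmless because both sides
  vanish.\<close>

lemma qbracket_square:
  assumes "q \<noteq> 0"
  shows "qbracket (q ^ 2) j = q powi (int j - 1) * qint q j"
proof -
  have "q powi (int j - 1) * qint q j = (\<Sum>i<j. (q ^ 2) ^ (j - Suc i))"
    unfolding qint_def sum_distrib_left
  proof (intro sum.cong refl)
    fix i assume "i \<in> {..<j}"
    then have "int j - 1 + (int j - 1 - 2 * int i) = int (2 * (j - Suc i))"
      by auto
    then have "q powi (int j - 1) * q powi (int j - 1 - 2 * int i) = q powi int (2 * (j - Suc i))"
      using power_int_add[of q "int j - 1" "int j - 1 - 2 * int i"] assms by simp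
    then show "q powi (int j - 1) * q powi (int j - 1 - 2 * int i) = (q ^ 2) ^ (j - Suc i)"
      by (simp only: power_int_of_nat power_mult)
  qed
  also have "\<dots> = (\<Sum>i<j. (q ^ 2) ^ i)"
    by (rule sum.nat_diff_reindex)
  finally show ?thesis by (simp add: qbracket_def)
qed

lemma qbracket_diff: "j \<le> n \<Longrightarrow> qbracket Q n - qbracket Q j = Q ^ j * qbracket Q (n - j)"
proof (induction n)
  case (Suc n)
  show ?case
  proof (cases "j = Suc n")
    case False
    then have j: "j \<le> n" using Suc.prems by simp
    have "Q ^ n = Q ^ j * Q ^ (n - j)" using j by (simp flip: power_add)
    then show ?thesis
      using Suc.IH[OF j] j by (simp add: Suc_diff_le qbracket_Suc algebra_simps)
  qed simp
qed simp

lemma qfact_nonzero: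
  assumes "\<And>k. 2 \<le> k \<Longrightarrow> k \<le> n \<Longrightarrow> qint q k \<noteq> 0"
  shows "qfact q n \<noteq> 0"
proof -
  have "qint q k \<noteq> 0" if "k \<in> {1..n}" for k
    using that assms[of k] by (cases "k = 1") (auto simp: qint_def)
  then show ?thesis by (simp add: qfact_def)
qed

text \<open>This is the value of the product in the theorem under the character sending each
  generator to q, for m + 1 strands. By \<open>qbracket_diff\<close> the factor at j is Q^j
  [m+1-j]_Q, that is q^(m+j) [m+1-j]_q. The exponents m + j add up to m (3m - 1) / 2, which is (n -
  1) (3n - 4) / 2 for n = m + 1, and the remaining quantum integers make up the factorial.\<close>

lemma prod_qbracket_diff:
  fixes q :: "'k::field"
  assumes q: "q \<noteq> 0"
  shows "(\<Prod>j<m. qbracket (q ^ 2) (Suc m) - qbracket (q ^ 2) j) =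
    q powi (int m * (3 * int m - 1) div 2) * qfact q (Suc m)"
proof -
  have *: "qbracket (q ^ 2) (Suc m) - qbracket (q ^ 2) j = q ^ (m + j) * qint q (Suc m - j)"
    if "j < m" for j
  proof -
    have "q ^ (2 * j) * q powi (int (Suc m - j) - 1) = q powi (int (2 * j) + (int (Suc m - j) - 1))"
      using power_int_add[of q "int (2 * j)" "int (Suc m - j) - 1"] q by (simp only: power_int_of_nat) simp
    also have "int (2 * j) + (int (Suc m - j) - 1) = int (m + j)"
      using that by simp
    finally have pow: "q ^ (2 * j) * q powi (int (Suc m - j) - 1) = q ^ (m + j)"
      by (simp only: power_int_of_nat)
    have "qbracket (q ^ 2) (Suc m) - qbracket (q ^ 2) j = (q ^ 2) ^ j * qbracket (q ^ 2) (Suc m - j)"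
      using that by (intro qbracket_diff) simp
    also have "\<dots> = q ^ (2 * j) * q powi (int (Suc m - j) - 1) * qint q (Suc m - j)"
      by (simp only: qbracket_square[OF q] power_mult mult.assoc)
    finally show ?thesis by (simp only: pow)
  qed
  have "(\<Prod>j<m. qbracket (q ^ 2) (Suc m) - qbracket (q ^ 2) j) =
      (\<Prod>j<m. q ^ (m + j)) * (\<Prod>j<m. qint q (Suc m - j))"
    by (simp add: * prod.distrib)
  also have "(\<Prod>j<m. q ^ (m + j)) = q ^ (\<Sum>j<m. m + j)"
    by (simp add: power_sum)
  also have "\<dots> = q powi (int m * (3 * int m - 1) div 2)"
  proof -
    \<comment> \<open>The offset k is kept apart from the number m of terms: with m in both roles,
      the induction would change every summand.\<close>
    have "2 * int (\<Sum>j<m. k + j) = int m * (2 * int k + int m - 1)" for k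
      by (induction m) (auto simp: algebra_simps)
    from this[of m] have "int m * (3 * int m - 1) div 2 = int (\<Sum>j<m. m + j)"
      by (simp add: algebra_simps)
    then show ?thesis by (simp only: power_int_of_nat)
  qed
  also have "(\<Prod>j<m. qint q (Suc m - j)) = qfact q (Suc m)"
  proof -
    have "(\<Prod>j<m. qint q (Suc m - j)) = (\<Prod>j<m. qint q (Suc (m - Suc j) + 1))"
      by (rule prod.cong) (auto simp: Suc_diff_Suc Suc_diff_le)
    also have "\<dots> = (\<Prod>j<m. qint q (Suc j + 1))"
      by (rule prod.nat_diff_reindex[where g = "\<lambda>j. qint q (Suc j + 1)"])
    \<comment> \<open>The left side starts at [2]_q; the additional factor [1]_q on the right is
      1.\<close>
    also have "\<dots> = (\<Prod>j=1..Suc m. qint q j)"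
      by (induction m) (simp_all add: qint_def)
    finally show ?thesis by (simp add: qfact_def)
  qed
  finally show ?thesis .
qed

section \<open>Shuffles\<close>

lemma (in ring) ring_prod_list_closed:
  "set xs \<subseteq> carrier R \<Longrightarrow> ring_prod_list R xs \<in> carrier R"
  by (induction xs) (auto simp: ring_prod_list_def)

lemma (in ring) ring_prod_list_append:
  "set xs \<subseteq> carrier R \<Longrightarrow> set ys \<subseteq> carrier R \<Longrightarrow>
    ring_prod_list R (xs @ ys) = ring_prod_list R xs \<otimes> ring_prod_list R ys"
  using ring_prod_list_closed[of ys]
  by (induction xs) (auto simp: ring_prod_list_def m_assoc ring_prod_list_closed[unfolded ring_prod_list_def])

lemma (in ring) ring_prod_list_commute:
  assumes "x \<in> carrier R" "set xs \<subseteq> carrier R" "\<And>y. y \<in> set xs \<Longrightarrow> x \<otimes> y = y \<otimes> x"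
  shows "x \<otimes> ring_prod_list R xs = ring_prod_list R xs \<otimes> x"
  using assms(2,3)
proof (induction xs)
  case (Cons y ys)
  let ?p = "foldr (\<otimes>) ys \<one>"
  have cl: "y \<in> carrier R" "?p \<in> carrier R"
    using Cons.prems ring_prod_list_closed[of ys] by (auto simp: ring_prod_list_def)
  have "x \<otimes> (y \<otimes> ?p) = y \<otimes> (x \<otimes> ?p)"
    using cl assms(1) Cons.prems(2)[of y] by (simp add: m_assoc[symmetric])
  then show ?case
    using Cons cl assms(1) by (simp add: ring_prod_list_def m_assoc)
qed (use assms(1) in \<open>simp add: ring_prod_list_def\<close>)

section \<open>Central scalars and the Hecke relations in an abstract ring\<close>

locale scalar_ring = ring R for R :: "('a, 'm) ring_scheme" (structure) +
  fixes c :: "'k::field \<Rightarrow> 'a"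
  assumes c_closed [simp, intro]: "c a \<in> carrier R"
    and c_add: "c (a + b) = c a \<oplus> c b"
    and c_mult: "c (a * b) = c a \<otimes> c b"
    and c_one: "c 1 = \<one>"
    and c_central: "x \<in> carrier R \<Longrightarrow> x \<otimes> c a = c a \<otimes> x"
begin

lemma c_left_commute:
  "x \<in> carrier R \<Longrightarrow> y \<in> carrier R \<Longrightarrow> x \<otimes> (c a \<otimes> y) = c a \<otimes> (x \<otimes> y)"
  by (simp add: m_assoc[symmetric] c_central)

lemma c_0: "c 0 = \<zero>"
  using c_add[of 0 0] by (metis add.r_cancel_one' add_0 c_closed)

lemma c_minus: "c (- a) = \<ominus> c a"
  using c_add[of "- a" a] by (simp add: c_0 minus_equality)

lemma c_diff: "c (a - b) = c a \<ominus> c b"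
  using c_add[of a "- b"] by (simp add: c_minus minus_eq)

lemma c_mult_assoc: "x \<in> carrier R \<Longrightarrow> c a \<otimes> (c b \<otimes> x) = c (a * b) \<otimes> x"
  by (simp add: c_mult m_assoc)

lemma c_mult_c_mult:
  "x \<in> carrier R \<Longrightarrow> y \<in> carrier R \<Longrightarrow> (c a \<otimes> x) \<otimes> (c b \<otimes> y) = c (a * b) \<otimes> (x \<otimes> y)"
  by (simp add: m_assoc c_left_commute[of x] c_mult_assoc)

lemma c_mult_cancel:
  assumes "a \<noteq> 0" "x \<in> carrier R" "y \<in> carrier R" "c a \<otimes> x = c a \<otimes> y"
  shows "x = y"
proof -
  have "c (inverse a) \<otimes> (c a \<otimes> x) = c (inverse a) \<otimes> (c a \<otimes> y)"
    using assms(4) by simp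
  then show ?thesis using assms(1-3) by (simp add: c_mult_assoc c_one)
qed

end

text \<open>Here \<open>t i\<close> stands for q times the i-th generator, \<open>Q\<close> for the
  square of q, and \<open>n\<close> for the number of strands. The quadratic relation is (t - Q) (t
  + 1) = 0, arranged without subtraction so that it can be used by distributing and collecting
  terms.\<close>

locale hecke_relations = scalar_ring R c
  for R :: "('a, 'm) ring_scheme" (structure) and c :: "'k::field \<Rightarrow> 'a" +
  fixes Q :: 'k and t :: "nat \<Rightarrow> 'a" and n :: nat
  assumes t_closed [simp, intro]: "0 < i \<Longrightarrow> i < n \<Longrightarrow> t i \<in> carrier R"
    and t_square: "0 < i \<Longrightarrow> i < n \<Longrightarrow> t i \<otimes> t i \<oplus> t i = c Q \<otimes> t i \<oplus> c Q"
    and t_braid: "0 < i \<Longrightarrow> Suc i < n \<Longrightarrow>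
      t (Suc i) \<otimes> (t i \<otimes> t (Suc i)) = t i \<otimes> (t (Suc i) \<otimes> t i)"
    and t_commute: "0 < i \<Longrightarrow> Suc i < j \<Longrightarrow> j < n \<Longrightarrow> t i \<otimes> t j = t j \<otimes> t i"
begin

text \<open>\<open>shuf m\<close> is the 1-shuffle on \<open>m + 1\<close> strands, \<open>shuf' m\<close> its mirror image, and
  \<open>full m\<close> the sum of all standard basis elements of the Hecke algebra on \<open>m + 1\<close> strands.\<close>

primrec shuf :: "nat \<Rightarrow> 'a" where
  "shuf 0 = \<one>"
| "shuf (Suc m) = \<one> \<oplus> shuf m \<otimes> t (Suc m)"

primrec shuf' :: "nat \<Rightarrow> 'a" where
  "shuf' 0 = \<one>"
| "shuf' (Suc m) = \<one> \<oplus> t (Suc m) \<otimes> shuf' m"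

primrec full :: "nat \<Rightarrow> 'a" where
  "full 0 = \<one>"
| "full (Suc m) = shuf (Suc m) \<otimes> full m"

lemma shuf_closed [simp, intro]: "m < n \<Longrightarrow> shuf m \<in> carrier R"
  by (induction m) auto

lemma shuf'_closed [simp, intro]: "m < n \<Longrightarrow> shuf' m \<in> carrier R"
  by (induction m) auto

lemma full_closed [simp, intro]: "m < n \<Longrightarrow> full m \<in> carrier R"
  by (induction m) (auto simp del: shuf.simps)

lemma mult_commute_mult:
  assumes "x \<in> carrier R" "y \<in> carrier R" "z \<in> carrier R" "x \<otimes> z = z \<otimes> x" "y \<otimes> z = z \<otimes> y"
  shows "x \<otimes> y \<otimes> z = z \<otimes> (x \<otimes> y)"
  using assms by (metis m_assoc)

text \<open>Only \<open>t 1\<close>, ..., \<open>t m\<close> occur in \<open>shuf m\<close>, and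
  each of them is at distance at least two from \<open>t j\<close>. The two lemmas that follow rest
  on the same observation.\<close>

lemma shuf_commute: "Suc m < j \<Longrightarrow> j < n \<Longrightarrow> shuf m \<otimes> t j = t j \<otimes> shuf m"
proof (induction m)
  case (Suc m)
  then have "shuf m \<otimes> t (Suc m) \<otimes> t j = t j \<otimes> (shuf m \<otimes> t (Suc m))"
    by (intro mult_commute_mult) (auto intro: t_commute)
  then show ?case using Suc.prems by (simp add: l_distr r_distr)
qed simp

lemma shuf'_commute: "Suc m < j \<Longrightarrow> j < n \<Longrightarrow> shuf' m \<otimes> t j = t j \<otimes> shuf' m"
proof (induction m)
  case (Suc m)
  then have "t (Suc m) \<otimes> shuf' m \<otimes> t j = t j \<otimes> (t (Suc m) \<otimes> shuf' m)"
    by (intro mult_commute_mult) (auto intro: t_commute)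
  then show ?case using Suc.prems by (simp add: l_distr r_distr)
qed simp

lemma full_commute: "Suc m < j \<Longrightarrow> j < n \<Longrightarrow> full m \<otimes> t j = t j \<otimes> full m"
proof (induction m)
  case (Suc m)
  then have "shuf (Suc m) \<otimes> full m \<otimes> t j = t j \<otimes> (shuf (Suc m) \<otimes> full m)"
    by (intro mult_commute_mult shuf_commute shuf_closed) auto
  then show ?case by simp
qed simp

section \<open>Eigenvector relations for shuffles and for their full product\<close>

lemma t_square_left:
  "0 < i \<Longrightarrow> i < n \<Longrightarrow> x \<in> carrier R \<Longrightarrow>
    t i \<otimes> (t i \<otimes> x) \<oplus> t i \<otimes> x = c Q \<otimes> (t i \<otimes> x) \<oplus> c Q \<otimes> x"
  using t_square[of i] by (simp add: m_assoc[symmetric] l_distr[symmetric])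

lemma t_square_right:
  "0 < i \<Longrightarrow> i < n \<Longrightarrow> x \<in> carrier R \<Longrightarrow>
    x \<otimes> (t i \<otimes> t i) \<oplus> x \<otimes> t i = c Q \<otimes> (x \<otimes> t i) \<oplus> c Q \<otimes> x"
  using t_square[of i] by (simp add: r_distr[symmetric])
    (simp add: r_distr c_left_commute c_central)

text \<open>In the induction step the left side is (1 + s a) (s a) with s = 1 + u b, which expands
  to (s a a + s a) + s a u b a. The quadratic relation for a handles the bracket. In the last term a
  commutes with u, the braid relation turns a b a into b a b, and the induction hypothesis for s u b
  extracts \<open>Q\<close>. The results recombine to \<open>Q\<close> times (1 + s a) s.\<close>

lemma shuf_shuf_t:
  "Suc m < n \<Longrightarrow> shuf (Suc m) \<otimes> (shuf m \<otimes> t (Suc m)) = c Q \<otimes> (shuf (Suc m) \<otimes> shuf m)"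
proof (induction m)
  case 0
  then show ?case using t_square[of 1] by (simp add: l_distr r_distr a_comm)
next
  case (Suc m)
  define a b u s where "a = t (Suc (Suc m))" and "b = t (Suc m)" and "u = shuf m"
    and "s = shuf (Suc m)"
  have cl [simp]: "a \<in> carrier R" "b \<in> carrier R" "u \<in> carrier R" "s \<in> carrier R"
    using Suc.prems by (auto simp: a_def b_def u_def s_def simp del: shuf.simps)
  have s: "s = \<one> \<oplus> u \<otimes> b" by (simp add: s_def u_def b_def)
  have IH: "s \<otimes> (u \<otimes> b) = c Q \<otimes> (s \<otimes> u)"
    using Suc by (simp add: s_def u_def b_def)
  have au: "a \<otimes> u = u \<otimes> a"
    using Suc.prems by (simp add: a_def u_def shuf_commute)
  have braid: "a \<otimes> (b \<otimes> a) = b \<otimes> (a \<otimes> b)"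
    using Suc.prems by (simp add: a_def b_def t_braid)
  have sq: "s \<otimes> (a \<otimes> a) \<oplus> s \<otimes> a = c Q \<otimes> (s \<otimes> a) \<oplus> c Q \<otimes> s"
    using Suc.prems t_square_right[of "Suc (Suc m)" s] by (simp add: a_def)
  have "s \<otimes> (a \<otimes> (u \<otimes> (b \<otimes> a))) = s \<otimes> (u \<otimes> (a \<otimes> (b \<otimes> a)))"
    using au by (simp add: m_assoc[symmetric])
  also have "\<dots> = (s \<otimes> (u \<otimes> b)) \<otimes> (a \<otimes> b)"
    by (simp add: braid m_assoc)
  also have "\<dots> = c Q \<otimes> (s \<otimes> (u \<otimes> (a \<otimes> b)))"
    by (simp add: IH m_assoc)
  also have "\<dots> = c Q \<otimes> (s \<otimes> (a \<otimes> (u \<otimes> b)))"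
    using au by (simp add: m_assoc[symmetric])
  finally have far: "s \<otimes> (a \<otimes> (u \<otimes> (b \<otimes> a))) = c Q \<otimes> (s \<otimes> (a \<otimes> (u \<otimes> b)))" .
  \<comment> \<open>Only the inner s is expanded; the leftmost s stays intact so that the outcome
    matches \<open>far\<close>.\<close>
  have sas: "s \<otimes> (a \<otimes> s) = s \<otimes> a \<oplus> s \<otimes> (a \<otimes> (u \<otimes> b))"
    by (subst (2) s) (simp add: r_distr)
  have sasa: "s \<otimes> (a \<otimes> (s \<otimes> a)) = s \<otimes> (a \<otimes> a) \<oplus> s \<otimes> (a \<otimes> (u \<otimes> (b \<otimes> a)))"
    by (subst (2) s) (simp add: r_distr l_distr m_assoc)
  have "(\<one> \<oplus> s \<otimes> a) \<otimes> (s \<otimes> a) = (s \<otimes> (a \<otimes> a) \<oplus> s \<otimes> a) \<oplus> s \<otimes> (a \<otimes> (u \<otimes> (b \<otimes> a)))"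
    by (simp add: l_distr m_assoc sasa a_ac)
  also have "\<dots> = c Q \<otimes> (s \<oplus> s \<otimes> a \<oplus> s \<otimes> (a \<otimes> (u \<otimes> b)))"
    unfolding sq far by (simp add: r_distr a_ac)
  also have "\<dots> = c Q \<otimes> ((\<one> \<oplus> s \<otimes> a) \<otimes> s)"
    by (simp add: l_distr m_assoc sas a_ac)
  finally show ?case by (simp add: s_def a_def)
qed

text \<open>This is \<open>shuf_shuf_t\<close> with all products reversed. A ring satisfying the
  relations need not carry an anti-automorphism fixing every \<open>t i\<close>, so the argument is
  run again with the factors in the opposite order.\<close>

lemma t_shuf'_shuf':
  "Suc m < n \<Longrightarrow> t (Suc m) \<otimes> (shuf' m \<otimes> shuf' (Suc m)) = c Q \<otimes> (shuf' m \<otimes> shuf' (Suc m))"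
proof (induction m)
  case 0
  then show ?case using t_square[of 1] by (simp add: l_distr r_distr a_comm)
next
  case (Suc m)
  define a b u s where "a = t (Suc (Suc m))" and "b = t (Suc m)" and "u = shuf' m"
    and "s = shuf' (Suc m)"
  have cl [simp]: "a \<in> carrier R" "b \<in> carrier R" "u \<in> carrier R" "s \<in> carrier R"
    using Suc.prems by (auto simp: a_def b_def u_def s_def simp del: shuf'.simps)
  have s: "s = \<one> \<oplus> b \<otimes> u" by (simp add: s_def u_def b_def)
  have IH: "b \<otimes> (u \<otimes> s) = c Q \<otimes> (u \<otimes> s)"
    using Suc by (simp add: s_def u_def b_def)
  have au: "a \<otimes> u = u \<otimes> a"
    using Suc.prems by (simp add: a_def u_def shuf'_commute)
  have au': "a \<otimes> (u \<otimes> s) = u \<otimes> (a \<otimes> s)"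
    using au by (simp add: m_assoc[symmetric])
  have braid: "a \<otimes> (b \<otimes> a) = b \<otimes> (a \<otimes> b)"
    using Suc.prems by (simp add: a_def b_def t_braid)
  have sq: "a \<otimes> (a \<otimes> s) \<oplus> a \<otimes> s = c Q \<otimes> (a \<otimes> s) \<oplus> c Q \<otimes> s"
    using Suc.prems t_square_left[of "Suc (Suc m)" s] by (simp add: a_def)
  have "a \<otimes> (b \<otimes> (u \<otimes> (a \<otimes> s))) = (a \<otimes> (b \<otimes> a)) \<otimes> (u \<otimes> s)"
    by (simp add: au'[symmetric] m_assoc)
  also have "\<dots> = c Q \<otimes> (b \<otimes> (u \<otimes> (a \<otimes> s)))"
    by (simp add: braid m_assoc IH c_left_commute au')
  finally have far: "a \<otimes> (b \<otimes> (u \<otimes> (a \<otimes> s))) = c Q \<otimes> (b \<otimes> (u \<otimes> (a \<otimes> s)))" .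
  have sas: "s \<otimes> (a \<otimes> s) = a \<otimes> s \<oplus> b \<otimes> (u \<otimes> (a \<otimes> s))"
    by (subst (1) s) (simp add: l_distr m_assoc)
  have "a \<otimes> (s \<otimes> (\<one> \<oplus> a \<otimes> s)) =
      (a \<otimes> (a \<otimes> s) \<oplus> a \<otimes> s) \<oplus> a \<otimes> (b \<otimes> (u \<otimes> (a \<otimes> s)))"
    by (simp add: r_distr sas a_ac)
  also have "\<dots> = c Q \<otimes> (s \<oplus> a \<otimes> s \<oplus> b \<otimes> (u \<otimes> (a \<otimes> s)))"
    unfolding sq far by (simp add: r_distr a_ac)
  also have "\<dots> = c Q \<otimes> (s \<otimes> (\<one> \<oplus> a \<otimes> s))"
    by (simp add: r_distr sas a_ac)
  finally show ?case by (simp add: s_def a_def)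
qed

text \<open>Expanding \<open>shuf (Suc m) = \<one> \<oplus> shuf m \<otimes> t (Suc m)\<close> in the right factor, the claim amounts
  to \<open>shuf_shuf_t\<close>.\<close>

lemma shuf_square:
  assumes "Suc m < n"
  shows "shuf (Suc m) \<otimes> shuf (Suc m) = shuf (Suc m) \<oplus> c Q \<otimes> (shuf (Suc m) \<otimes> shuf m)"
proof -
  have cl: "shuf (Suc m) \<in> carrier R" "shuf m \<otimes> t (Suc m) \<in> carrier R"
    using assms by (auto simp del: shuf.simps)
  have "shuf (Suc m) \<otimes> (\<one> \<oplus> shuf m \<otimes> t (Suc m)) =
      shuf (Suc m) \<oplus> shuf (Suc m) \<otimes> (shuf m \<otimes> t (Suc m))"
    using cl by (simp add: r_distr del: shuf.simps)
  then show ?thesis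
    using shuf_shuf_t[OF assms] by simp
qed

text \<open>For i at most m the right factor \<open>full m\<close> of \<open>full (Suc m)\<close>
  absorbs \<open>t i\<close> by induction. For i = m + 1 the last two shuffles are exposed:
  \<open>t i\<close> commutes past \<open>full (m - 1)\<close> and is absorbed by
  \<open>shuf_shuf_t\<close>. The case m = 0 is separate because there only one nontrivial shuffle
  is present.\<close>

lemma full_t: "m < n \<Longrightarrow> 0 < i \<Longrightarrow> i \<le> m \<Longrightarrow> full m \<otimes> t i = c Q \<otimes> full m"
proof (induction m)
  case (Suc m)
  note [simp del] = shuf.simps
  have cl [simp]: "t i \<in> carrier R" "shuf (Suc m) \<in> carrier R" "full m \<in> carrier R"
    "shuf m \<in> carrier R" "t (Suc m) \<in> carrier R"
    using Suc.prems by auto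
  show ?case
  proof (cases "i = Suc m")
    case False
    then show ?thesis using Suc by (simp add: m_assoc c_left_commute)
  next
    case i: True
    show ?thesis
    proof (cases m)
      case 0
      then show ?thesis
        using Suc.prems shuf_shuf_t[of 0] unfolding i by (simp add: shuf.simps(1))
    next
      case (Suc k)
      have cl' [simp]: "full k \<in> carrier R" using Suc Suc.prems by auto
      have full: "full (Suc m) = shuf (Suc m) \<otimes> (shuf m \<otimes> full k)"
        using Suc by simp
      have "full k \<otimes> t i = t i \<otimes> full k"
        using Suc i Suc.prems by (intro full_commute) auto
      then have "full (Suc m) \<otimes> t i = (shuf (Suc m) \<otimes> (shuf m \<otimes> t i)) \<otimes> full k"
        unfolding full by (simp add: m_assoc)
      also have "\<dots> = c Q \<otimes> full (Suc m)"
        using Suc.prems shuf_shuf_t[of m] unfolding i full by (simp add: m_assoc)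
      finally show ?thesis .
    qed
  qed
qed simp

text \<open>By definition a shuffle is attached on the left; here its mirror image is attached on
  the right, so \<open>full\<close> equals its own mirror image. In the step,
  \<open>full (m+2)\<close> is \<open>full (m+1)\<close> plus
  \<open>shuf (m+1) \<otimes> t (m+2) \<otimes> full (m+1)\<close>. Only in the second summand is
  \<open>full (m+1)\<close> replaced by the induction hypothesis; then \<open>t (m+2)\<close> passes
  \<open>full m\<close>, and \<open>shuf (m+1) \<otimes> full m\<close> recombines to
  \<open>full (m+1)\<close>.\<close>

lemma full_Suc': "Suc m < n \<Longrightarrow> full (Suc m) = full m \<otimes> shuf' (Suc m)"
proof (induction m)
  case 0
  then show ?case by simp
next
  case (Suc m)
  have cl [simp]: "shuf (Suc m) \<in> carrier R" "full m \<in> carrier R" "shuf m \<in> carrier R"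
    "shuf' (Suc m) \<in> carrier R" "full (Suc m) \<in> carrier R"
    "t (Suc (Suc m)) \<in> carrier R" using Suc.prems by (auto simp del: shuf.simps shuf'.simps full.simps)
  have "full (Suc (Suc m)) =
      full (Suc m) \<oplus> shuf (Suc m) \<otimes> (t (Suc (Suc m)) \<otimes> (full m \<otimes> shuf' (Suc m)))"
    using Suc by (simp add: l_distr m_assoc del: full.simps(2) shuf.simps(2) shuf'.simps
      add: full.simps(2)[of "Suc m"] shuf.simps(2)[of "Suc m"])
  also have "t (Suc (Suc m)) \<otimes> (full m \<otimes> shuf' (Suc m)) =
      full m \<otimes> (t (Suc (Suc m)) \<otimes> shuf' (Suc m))"
    using Suc.prems full_commute[of m "Suc (Suc m)"]
    by (simp add: m_assoc[symmetric] del: shuf'.simps)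
  also have "full (Suc m) \<oplus> shuf (Suc m) \<otimes> (full m \<otimes> (t (Suc (Suc m)) \<otimes> shuf' (Suc m))) =
      full (Suc m) \<otimes> shuf' (Suc (Suc m))"
    by (simp add: r_distr m_assoc[symmetric] del: shuf'.simps(2) shuf.simps full.simps
      add: shuf'.simps(2)[of "Suc m"] full.simps(2)[symmetric])
  finally show ?case .
qed

text \<open>The mirror image of the argument for \<open>full_t\<close>, with the factorisation
  \<open>full_Suc'\<close> and the relation \<open>t_shuf'_shuf'\<close>.\<close>

lemma t_full: "m < n \<Longrightarrow> 0 < i \<Longrightarrow> i \<le> m \<Longrightarrow> t i \<otimes> full m = c Q \<otimes> full m"
proof (induction m)
  case (Suc m)
  note [simp del] = shuf'.simps full.simps
  have cl [simp]: "t i \<in> carrier R" "shuf' (Suc m) \<in> carrier R" "full m \<in> carrier R"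
    "shuf' m \<in> carrier R" "t (Suc m) \<in> carrier R"
    using Suc.prems by auto
  have full: "full (Suc m) = full m \<otimes> shuf' (Suc m)"
    using Suc.prems by (simp add: full_Suc')
  show ?case
  proof (cases "i = Suc m")
    case False
    then show ?thesis using Suc by (simp add: full m_assoc[symmetric])
  next
    case i: True
    show ?thesis
    proof (cases m)
      case 0
      then show ?thesis
        using Suc.prems t_shuf'_shuf'[of 0] full unfolding i by (simp add: shuf'.simps(1) full.simps(1))
    next
      case (Suc k)
      have cl' [simp]: "full k \<in> carrier R" using Suc Suc.prems by auto
      have full2: "full (Suc m) = full k \<otimes> (shuf' m \<otimes> shuf' (Suc m))"
        using Suc Suc.prems full_Suc'[of k] full by (simp add: m_assoc)
      have "full k \<otimes> t i = t i \<otimes> full k"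
        using Suc i Suc.prems by (intro full_commute) auto
      then have "t i \<otimes> full (Suc m) = full k \<otimes> (t i \<otimes> (shuf' m \<otimes> shuf' (Suc m)))"
        by (simp add: full2 m_assoc[symmetric])
      also have "\<dots> = c Q \<otimes> full (Suc m)"
        using i Suc.prems t_shuf'_shuf'[of m] by (simp add: full2 c_left_commute)
      finally show ?thesis .
    qed
  qed
qed simp

section \<open>From the product of shifted shuffles to the product of descending shuffles\<close>

primrec shufs :: "nat \<Rightarrow> nat \<Rightarrow> 'a" where
  "shufs N 0 = \<one>"
| "shufs N (Suc k) = shufs N k \<otimes> shuf (N - k)"

lemma shufs_closed [simp, intro]: "N < n \<Longrightarrow> shufs N k \<in> carrier R"
  by (induction k) auto

lemma shufs_full: "N < n \<Longrightarrow> k \<le> N \<Longrightarrow> shufs N k \<otimes> full (N - k) = full N"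
proof (induction k)
  case (Suc k)
  obtain d where d: "N - k = Suc d" "N - Suc k = d" using Suc.prems
    by (metis Suc_diff_Suc Suc_le_lessD)
  have "shuf (Suc d) \<in> carrier R" "full d \<in> carrier R"
    using Suc.prems d by (auto simp del: shuf.simps)
  then show ?case using Suc d by (simp add: m_assoc del: shuf.simps)
qed simp

text \<open>\<open>shufs N k\<close> consists of the first k factors of \<open>full N\<close>; it is
  the B_k of the overview for N + 1 strands. Multiplying the induction hypothesis on the right by
  the next factor s produces s s, which \<open>shuf_square\<close> splits: one part raises the
  coefficient from [k]_Q to [k]_Q + Q^k = [k+1]_Q, the other carries the next shuffle with
  Q^(k+1).\<close>

lemma shuf_shufs:
  "N < n \<Longrightarrow> k \<le> N \<Longrightarrow>
    shuf N \<otimes> shufs N k = c (qbracket Q k) \<otimes> shufs N k \<oplus> c (Q ^ k) \<otimes> (shufs N k \<otimes> shuf (N - k))"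
proof (induction k)
  case 0
  then show ?case by (simp add: c_0 c_one)
next
  case (Suc k)
  obtain d where d: "N - k = Suc d" "N - Suc k = d" using Suc.prems
    by (metis Suc_diff_Suc Suc_le_lessD)
  define B s u where "B = shufs N k" and "s = shuf (Suc d)" and "u = shuf d"
  have cl [simp]: "B \<in> carrier R" "s \<in> carrier R" "u \<in> carrier R" "shuf N \<in> carrier R"
    using Suc.prems d by (auto simp: B_def s_def u_def simp del: shuf.simps)
  have IH: "shuf N \<otimes> B = c (qbracket Q k) \<otimes> B \<oplus> c (Q ^ k) \<otimes> (B \<otimes> s)"
    using Suc d by (simp add: B_def s_def del: shuf.simps)
  have sq: "s \<otimes> s = s \<oplus> c Q \<otimes> (s \<otimes> u)"
    using shuf_square[of d] Suc.prems d by (simp add: s_def u_def del: shuf.simps)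
  have "shuf N \<otimes> (B \<otimes> s) = (c (qbracket Q k) \<otimes> B \<oplus> c (Q ^ k) \<otimes> (B \<otimes> s)) \<otimes> s"
    by (simp add: m_assoc[symmetric] IH)
  also have "\<dots> = c (qbracket Q k) \<otimes> (B \<otimes> s) \<oplus> c (Q ^ k) \<otimes> (B \<otimes> (s \<otimes> s))"
    by (simp add: l_distr m_assoc)
  also have "\<dots> = c (qbracket Q (Suc k)) \<otimes> (B \<otimes> s) \<oplus> c (Q ^ Suc k) \<otimes> (B \<otimes> (s \<otimes> u))"
    by (simp add: sq r_distr c_left_commute[of B] c_mult_assoc qbracket_Suc c_add l_distr a_assoc
      mult.commute)
  finally show ?case using d by (simp add: B_def s_def u_def m_assoc[symmetric] del: shuf.simps)
      (simp add: m_assoc B_def[symmetric] s_def[symmetric] u_def[symmetric] del: shuf.simps)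
qed

text \<open>The first k factors of the product in the theorem, with the constants in the form given
  by \<open>qbracket_square\<close>.\<close>

definition shuf_prod :: "nat \<Rightarrow> nat \<Rightarrow> 'a" where
  "shuf_prod N k = ring_prod_list R (map (\<lambda>j. shuf N \<ominus> c (qbracket Q j)) [0..<k])"

lemma shuf_prod_closed [simp, intro]: "N < n \<Longrightarrow> shuf_prod N k \<in> carrier R"
  unfolding shuf_prod_def by (intro ring_prod_list_closed) auto

lemma shuf_prod_Suc:
  "N < n \<Longrightarrow> shuf_prod N (Suc k) = shuf_prod N k \<otimes> (shuf N \<ominus> c (qbracket Q k))"
  unfolding shuf_prod_def by (simp add: ring_prod_list_append image_subset_iff)
    (simp add: ring_prod_list_def)

text \<open>All factors are \<open>shuf N\<close> minus a central scalar, so they commute. The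
  newest factor can therefore act from the left on \<open>shufs N k\<close>, where
  \<open>shuf_shufs\<close> cancels the subtracted constant and leaves Q^k times
  \<open>shufs N (Suc k)\<close>.\<close>

lemma shuf_prod_shufs:
  "N < n \<Longrightarrow> k \<le> N \<Longrightarrow> shuf_prod N k = c (Q ^ (\<Sum>j<k. j)) \<otimes> shufs N k"
proof (induction k)
  case 0
  then show ?case by (simp add: shuf_prod_def ring_prod_list_def c_one)
next
  case (Suc k)
  let ?f = "\<lambda>j. shuf N \<ominus> c (qbracket Q j)"
  have cl [simp]: "shuf N \<in> carrier R" "shufs N k \<in> carrier R" "shuf (N - k) \<in> carrier R"
    using Suc.prems by auto
  have "?f k \<otimes> shuf_prod N k = shuf_prod N k \<otimes> ?f k"
    unfolding shuf_prod_def
    by (rule ring_prod_list_commute)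
      (auto simp: minus_eq r_distr l_distr c_central[OF cl(1)] l_minus r_minus minus_add a_ac c_mult[symmetric] mult.commute)
  then have "shuf_prod N (Suc k) = ?f k \<otimes> (c (Q ^ (\<Sum>j<k. j)) \<otimes> shufs N k)"
    using Suc by (simp add: shuf_prod_Suc)
  also have "\<dots> = c (Q ^ (\<Sum>j<k. j)) \<otimes> (?f k \<otimes> shufs N k)"
    by (intro c_left_commute) auto
  also have "?f k \<otimes> shufs N k = c (Q ^ k) \<otimes> shufs N (Suc k)"
    using Suc.prems shuf_shufs[of N k] by (simp add: minus_eq l_distr l_minus)
      (simp add: a_ac r_neg1 r_neg2 r_neg a_assoc[symmetric])
  finally show ?case
    using Suc.prems by (simp add: c_mult_assoc power_add mult.commute)
qed

lemma shuf_prod_full: "N < n \<Longrightarrow> shuf_prod N N = c (Q ^ (\<Sum>j<N. j)) \<otimes> full N"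
  using shuf_prod_shufs[of N N] shufs_full[of N N] by simp

section \<open>Values of the product on eigenvectors and under characters\<close>

lemma shuf_mult_eigen:
  assumes S: "S \<in> carrier R" and eig: "\<And>i. 0 < i \<Longrightarrow> i < n \<Longrightarrow> t i \<otimes> S = c Q \<otimes> S"
  shows "m < n \<Longrightarrow> shuf m \<otimes> S = c (qbracket Q (Suc m)) \<otimes> S"
proof (induction m)
  case 0
  then show ?case using S by (simp add: qbracket_Suc c_one)
next
  case (Suc m)
  have "shuf (Suc m) \<otimes> S = c 1 \<otimes> S \<oplus> c (Q * qbracket Q (Suc m)) \<otimes> S"
    using Suc S eig[of "Suc m"] by (simp add: l_distr m_assoc c_left_commute[of "shuf m"] c_mult c_one)
  then show ?case
    using S by (simp add: qbracket_Suc'[of Q "Suc m"] c_add l_distr)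
qed

text \<open>On S the shuffle \<open>shuf N\<close> acts as [N+1]_Q, so each factor acts as a
  difference of two brackets. Applied to the candidate symmetrizer this gives idempotence, applied
  to any other symmetrizer it gives uniqueness.\<close>

lemma shuf_prod_mult_eigen:
  assumes S: "S \<in> carrier R" and eig: "\<And>i. 0 < i \<Longrightarrow> i < n \<Longrightarrow> t i \<otimes> S = c Q \<otimes> S"
    and N: "N < n"
  shows "shuf_prod N k \<otimes> S = c (\<Prod>j<k. qbracket Q (Suc N) - qbracket Q j) \<otimes> S"
proof (induction k)
  case 0
  then show ?case using S by (simp add: shuf_prod_def ring_prod_list_def c_one)
next
  case (Suc k)
  let ?f = "\<lambda>j. shuf N \<ominus> c (qbracket Q j)" and ?d = "\<lambda>j. qbracket Q (Suc N) - qbracket Q j"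
  have cl [simp]: "shuf N \<in> carrier R" using N by auto
  have P [simp]: "shuf_prod N k \<in> carrier R" using N by auto
  have "?f k \<otimes> S = c (?d k) \<otimes> S"
    using S shuf_mult_eigen[OF S eig N] by (simp add: minus_eq l_distr l_minus c_diff)
  then show ?case
    using S Suc by (simp add: shuf_prod_Suc[OF N] m_assoc c_left_commute[OF P] c_mult_assoc mult.commute)
qed

text \<open>The relations alone do not prevent the ring from being zero, so a character is what
  certifies that the product does not vanish. It takes the same value as the eigenvalue in
  \<open>shuf_prod_mult_eigen\<close>.\<close>

lemma character_shuf_prod:
  fixes \<chi> :: "'a \<Rightarrow> 'k"
  assumes add: "\<And>x y. x \<in> carrier R \<Longrightarrow> y \<in> carrier R \<Longrightarrow> \<chi> (x \<oplus> y) = \<chi> x + \<chi> y"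
    and mult: "\<And>x y. x \<in> carrier R \<Longrightarrow> y \<in> carrier R \<Longrightarrow> \<chi> (x \<otimes> y) = \<chi> x * \<chi> y"
    and scalar: "\<And>a. \<chi> (c a) = a"
    and t: "\<And>i. 0 < i \<Longrightarrow> i < n \<Longrightarrow> \<chi> (t i) = Q"
    and N: "N < n"
  shows "\<chi> (shuf_prod N k) = (\<Prod>j<k. qbracket Q (Suc N) - qbracket Q j)"
proof -
  have one: "\<chi> \<one> = 1" using scalar[of 1] by (simp add: c_one)
  have shuf: "\<chi> (shuf m) = qbracket Q (Suc m)" if "m < n" for m
    using that
  proof (induction m)
    case (Suc m)
    then show ?case
      by (simp add: add mult one t qbracket_Suc'[of Q "Suc m"] mult.commute)
  qed (simp add: one qbracket_Suc)
  have "\<chi> (shuf N \<ominus> c a) = qbracket Q (Suc N) - a" for a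
    using N by (simp add: minus_eq c_minus[symmetric] add shuf scalar)
  then show ?thesis
    using N by (induction k)
      (simp_all add: shuf_prod_Suc mult, simp add: shuf_prod_def ring_prod_list_def one)
qed

text \<open>This links the explicit sum to the recursion. For m + 1 the summand with index k + 1
  ends in the generator m + 1 and equals the summand with index k for m times
  \<open>t (Suc m)\<close>; the summand with index 0 is the new 1.\<close>

lemma finsum_shuf:
  assumes g: "\<And>i. 0 < i \<Longrightarrow> i < n \<Longrightarrow> g i \<in> carrier R"
    and t: "\<And>i. 0 < i \<Longrightarrow> i < n \<Longrightarrow> t i = c q \<otimes> g i"
  shows "m < n \<Longrightarrow>
    (\<Oplus>k\<in>{..m}. c (q ^ k) \<otimes> ring_prod_list R (map g [Suc m - k..<Suc m])) = shuf m"
proof (induction m)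
  case 0
  then show ?case by (simp add: ring_prod_list_def c_one)
next
  case (Suc m)
  define f where "f j k = c (q ^ k) \<otimes> ring_prod_list R (map g [Suc j - k..<Suc j])" for j k
  have cl: "f j k \<in> carrier R" if "j < n" "k \<le> j" for j k
    unfolding f_def using that by (intro m_closed c_closed ring_prod_list_closed) (auto intro!: g)
  have "f (Suc m) (Suc k) = f m k \<otimes> t (Suc m)" if "k \<le> m" for k
  proof -
    let ?p = "ring_prod_list R (map g [Suc m - k..<Suc m])"
    have p: "?p \<in> carrier R"
      using that Suc.prems by (intro ring_prod_list_closed) (auto intro!: g)
    have "[Suc (Suc m) - Suc k..<Suc (Suc m)] = [Suc m - k..<Suc m] @ [Suc m]"
      by simp
    then have "ring_prod_list R (map g [Suc (Suc m) - Suc k..<Suc (Suc m)]) = ?p \<otimes> g (Suc m)"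
      using that Suc.prems g
      by (simp only: map_append, subst ring_prod_list_append) (auto simp: ring_prod_list_def)
    then show ?thesis
      using Suc.prems p g[of "Suc m"] by (simp only: f_def t[of "Suc m"] c_mult_c_mult)
        (simp add: mult.commute c_mult_c_mult)
  qed
  then have "(\<Oplus>k\<in>{..m}. f (Suc m) (Suc k)) = (\<Oplus>k\<in>{..m}. f m k \<otimes> t (Suc m))"
    using Suc.prems cl by (intro finsum_cong') auto
  also have "\<dots> = (\<Oplus>k\<in>{..m}. f m k) \<otimes> t (Suc m)"
    using Suc.prems cl by (intro finsum_ldistr[symmetric]) auto
  also have "(\<Oplus>k\<in>{..m}. f m k) = shuf m"
    using Suc by (simp add: f_def)
  finally have "(\<Oplus>k\<in>{..Suc m}. f (Suc m) k) = shuf m \<otimes> t (Suc m) \<oplus> f (Suc m) 0"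
    using Suc.prems cl by (subst finsum_Suc2) auto
  then show ?case
    using Suc.prems by (simp add: f_def ring_prod_list_def c_one a_comm)
qed

end

section \<open>The trivial character\<close>

text \<open>The linear extension of e to the group algebra; for the constant e = 1 it is the usual
  augmentation.\<close>

definition augment :: "('g \<Rightarrow> 'k::field) \<Rightarrow> ('g \<Rightarrow> 'k) \<Rightarrow> 'k" where
  "augment e f = (\<Sum>x\<in>supp f. f x * e x)"

text \<open>The field as a ring record, which makes it a possible target of
  \<open>ring_hom_ring\<close>.\<close>

definition type_ring :: "'k::field ring" where
  "type_ring = \<lparr>carrier = UNIV, mult = (*), one = 1, zero = 0, add = (+)\<rparr>"

lemma ring_type_ring: "ring (type_ring :: 'k::field ring)"
proof -
  have "abelian_group (type_ring :: 'k ring)"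
    by (rule abelian_groupI) (auto simp: type_ring_def algebra_simps intro: exI[of _ "- x" for x])
  moreover have "Group.monoid (type_ring :: 'k ring)"
    by (rule monoidI) (auto simp: type_ring_def algebra_simps)
  ultimately show ?thesis
    by (rule ringI) (auto simp: type_ring_def algebra_simps)
qed

lemma type_ring_minus: "\<ominus>\<^bsub>type_ring\<^esub> x = - x"
  by (rule abelian_group.minus_equality[OF ring.is_abelian_group[OF ring_type_ring]])
    (auto simp: type_ring_def)

lemma augment_superset:
  "finite A \<Longrightarrow> supp f \<subseteq> A \<Longrightarrow> augment e f = (\<Sum>x\<in>A. f x * e x)"
  unfolding augment_def by (rule sum.mono_neutral_left) (auto simp: supp_def)

lemma augment_single: "augment e (single g a) = a * e g"
  by (subst augment_superset[of "{g}"]) (auto simp: supp_def single_def)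

text \<open>For multiplicativity, the sum over group elements x is exchanged with the sum over pairs
  from the two supports. Each pair then contributes exactly once, at x equal to its product, where e
  factorises.\<close>

lemma augment_ring_hom:
  fixes e :: "'g \<Rightarrow> 'k::field"
  assumes G: "Group.monoid G" and one: "e \<one>\<^bsub>G\<^esub> = 1"
    and mult: "\<And>x y. x \<in> carrier G \<Longrightarrow> y \<in> carrier G \<Longrightarrow> e (x \<otimes>\<^bsub>G\<^esub> y) = e x * e y"
  shows "ring_hom_ring (group_algebra G) type_ring (augment e)"
proof (rule ring_hom_ringI)
  let ?A = "group_algebra G :: ('g \<Rightarrow> 'k) ring"
  show "ring ?A" by (rule ring_group_algebra[OF G])
  show "ring (type_ring :: 'k ring)" by (rule ring_type_ring)
  show "augment e f \<in> carrier type_ring" for f by (simp add: type_ring_def)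
  show "augment e \<one>\<^bsub>?A\<^esub> = \<one>\<^bsub>type_ring\<^esub>"
    by (simp add: group_algebra_def type_ring_def augment_single one)
  fix f g assume f: "f \<in> carrier ?A" and g: "g \<in> carrier ?A"
  then have fin: "finite (supp f)" "finite (supp g)"
    and sub: "supp f \<subseteq> carrier G" "supp g \<subseteq> carrier G"
    by (auto simp: group_algebra_def)
  show "augment e (f \<oplus>\<^bsub>?A\<^esub> g) = augment e f \<oplus>\<^bsub>type_ring\<^esub> augment e g"
  proof -
    let ?U = "supp f \<union> supp g"
    have "supp (f \<oplus>\<^bsub>?A\<^esub> g) \<subseteq> ?U" by (auto simp: supp_def group_algebra_def)
    then have "augment e (f \<oplus>\<^bsub>?A\<^esub> g) = (\<Sum>x\<in>?U. (f \<oplus>\<^bsub>?A\<^esub> g) x * e x)"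
      using fin by (intro augment_superset) auto
    moreover have "augment e f = (\<Sum>x\<in>?U. f x * e x)" "augment e g = (\<Sum>x\<in>?U. g x * e x)"
      using fin by (auto intro!: augment_superset)
    ultimately show ?thesis
      by (simp add: group_algebra_def type_ring_def sum.distrib algebra_simps)
  qed
  show "augment e (f \<otimes>\<^bsub>?A\<^esub> g) = augment e f \<otimes>\<^bsub>type_ring\<^esub> augment e g"
  proof -
    let ?P = "supp f \<times> supp g" and ?U = "(\<lambda>(y, z). y \<otimes>\<^bsub>G\<^esub> z) ` (supp f \<times> supp g)"
    have "augment e (f \<otimes>\<^bsub>?A\<^esub> g) = (\<Sum>x\<in>?U. (f \<otimes>\<^bsub>?A\<^esub> g) x * e x)"
      using fin by (intro augment_superset supp_group_algebra_mult) auto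
    also have "\<dots> = (\<Sum>x\<in>?U. \<Sum>p\<in>?P. if fst p \<otimes>\<^bsub>G\<^esub> snd p = x then f (fst p) * g (snd p) * e x else 0)"
      unfolding group_algebra_def
      by (simp add: sum_distrib_right case_prod_beta if_distrib[of "\<lambda>a. a * _"] cong: if_cong)
    also have "\<dots> = (\<Sum>p\<in>?P. \<Sum>x\<in>?U. if fst p \<otimes>\<^bsub>G\<^esub> snd p = x then f (fst p) * g (snd p) * e x else 0)"
      by (rule sum.swap)
    also have "\<dots> = (\<Sum>p\<in>?P. (f (fst p) * e (fst p)) * (g (snd p) * e (snd p)))"
    proof (rule sum.cong)
      fix p assume p: "p \<in> ?P"
      then have U: "fst p \<otimes>\<^bsub>G\<^esub> snd p \<in> ?U" by force
      have "finite ?U" using fin by simp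
      then have "(\<Sum>x\<in>?U. if fst p \<otimes>\<^bsub>G\<^esub> snd p = x then f (fst p) * g (snd p) * e x else 0) =
          f (fst p) * g (snd p) * e (fst p \<otimes>\<^bsub>G\<^esub> snd p)"
        by (simp only: sum.delta' U if_True)
      then show "(\<Sum>x\<in>?U. if fst p \<otimes>\<^bsub>G\<^esub> snd p = x then f (fst p) * g (snd p) * e x else 0) =
          (f (fst p) * e (fst p)) * (g (snd p) * e (snd p))"
        using p sub by (auto simp: mult subset_iff)
    qed simp
    also have "\<dots> = augment e f * augment e g"
      by (simp add: augment_def sum_product sum.cartesian_product case_prod_beta)
    finally show ?thesis by (simp add: type_ring_def)
  qed
qed

section \<open>The character of the braid group sending each generator to q\<close>

definition word_weight :: "'k::field \<Rightarrow> braid_word \<Rightarrow> 'k" where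
  "word_weight q w = prod_list (map (\<lambda>(i, b). if b then q else inverse q) w)"

text \<open>A representative is chosen arbitrarily; \<open>class_weight_class\<close> shows that the
  choice does not matter on classes of braid words.\<close>

definition class_weight :: "'k::field \<Rightarrow> braid_word set \<Rightarrow> 'k" where
  "class_weight q A = word_weight q (SOME w. w \<in> A)"

lemma word_weight_append: "word_weight q (u @ v) = word_weight q u * word_weight q v"
  by (simp add: word_weight_def)

text \<open>Cancelling letters have weights q and 1/q, and the two sides of each remaining relation
  contain equally many letters, all positive.\<close>

lemma braid_eq_word_weight:
  assumes "q \<noteq> 0"
  shows "braid_eq n u v \<Longrightarrow> word_weight q u = word_weight q v"
  by (induction rule: braid_eq.induct) (use assms in \<open>auto simp: word_weight_append, auto simp: word_weight_def\<close>)

lemma class_weight_class: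
  assumes "q \<noteq> 0" "w \<in> braid_words n"
  shows "class_weight q (braid_class n w) = word_weight q w"
proof -
  have "w \<in> braid_class n w"
    using assms by (simp add: braid_class_def braid_eq_refl)
  then have "(SOME v. v \<in> braid_class n w) \<in> braid_class n w" by (rule someI)
  then show ?thesis
    using assms(1) braid_eq_word_weight unfolding class_weight_def braid_class_def by fastforce
qed

lemma augment_class_weight_hom:
  assumes "q \<noteq> 0"
  shows "ring_hom_ring (braid_algebra n) type_ring (augment (class_weight q))"
proof (rule augment_ring_hom)
  show "Group.monoid (braid_group n)" by (intro group.is_monoid group_braid_group)
  show "class_weight q \<one>\<^bsub>braid_group n\<^esub> = 1"
    by (simp add: one_braid_group class_weight_class assms braid_words_Nil word_weight_def)
  show "class_weight q (x \<otimes>\<^bsub>braid_group n\<^esub> y) = class_weight q x * class_weight q y"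
    if "x \<in> carrier (braid_group n)" "y \<in> carrier (braid_group n)" for x y
    using that assms
    by (auto simp: carrier_braid_group braid_class_mult class_weight_class braid_words_append
      word_weight_append)
qed

section \<open>Basis elements of the group algebra\<close>

lemma single_mult:
  "single g a \<otimes>\<^bsub>group_algebra G\<^esub> single h b = single (g \<otimes>\<^bsub>G\<^esub> h) (a * b :: 'k::field)"
proof
  fix x
  have "(single g a \<otimes>\<^bsub>group_algebra G\<^esub> single h b) x =
      (\<Sum>y\<in>{g}. \<Sum>z\<in>{h}. if y \<otimes>\<^bsub>G\<^esub> z = x then single g a y * single h b z else 0)"
    by (rule group_algebra_mult_superset) (auto simp: supp_def single_def)
  then show "(single g a \<otimes>\<^bsub>group_algebra G\<^esub> single h b) x = single (g \<otimes>\<^bsub>G\<^esub> h) (a * b) x"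
    by (auto simp: single_def)
qed

lemma single_add:
  "single g a \<oplus>\<^bsub>group_algebra G\<^esub> single g b = single g (a + b :: 'k::field)"
  by (auto simp: single_def group_algebra_def)

lemma single_one_central:
  assumes "Group.monoid G" and f: "f \<in> carrier (group_algebra G)"
  shows "f \<otimes>\<^bsub>group_algebra G\<^esub> single \<one>\<^bsub>G\<^esub> a =
    single \<one>\<^bsub>G\<^esub> (a::'k::field) \<otimes>\<^bsub>group_algebra G\<^esub> f"
proof
  fix x
  interpret monoid G by fact
  have fin: "finite (supp f)" and sub: "\<And>y. y \<in> supp f \<Longrightarrow> y \<in> carrier G"
    using f by (auto simp: group_algebra_def)
  have s: "supp (single \<one>\<^bsub>G\<^esub> a) \<subseteq> {\<one>\<^bsub>G\<^esub>}" by (auto simp: supp_def single_def)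
  have "(f \<otimes>\<^bsub>group_algebra G\<^esub> single \<one>\<^bsub>G\<^esub> a) x =
      (\<Sum>y\<in>supp f. \<Sum>z\<in>{\<one>\<^bsub>G\<^esub>}. if y \<otimes>\<^bsub>G\<^esub> z = x then f y * single \<one>\<^bsub>G\<^esub> a z else 0)"
    by (rule group_algebra_mult_superset) (use fin s in auto)
  also have "\<dots> = (\<Sum>y\<in>supp f. \<Sum>z\<in>{\<one>\<^bsub>G\<^esub>}. if z \<otimes>\<^bsub>G\<^esub> y = x then single \<one>\<^bsub>G\<^esub> a z * f y else 0)"
    by (rule sum.cong) (auto simp: sub mult.commute)
  also have "\<dots> = (\<Sum>z\<in>{\<one>\<^bsub>G\<^esub>}. \<Sum>y\<in>supp f. if z \<otimes>\<^bsub>G\<^esub> y = x then single \<one>\<^bsub>G\<^esub> a z * f y else 0)"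
    by (rule sum.swap)
  also have "\<dots> = (single \<one>\<^bsub>G\<^esub> a \<otimes>\<^bsub>group_algebra G\<^esub> f) x"
    by (rule group_algebra_mult_superset[symmetric]) (use fin s in auto)
  finally show "(f \<otimes>\<^bsub>group_algebra G\<^esub> single \<one>\<^bsub>G\<^esub> a) x = (single \<one>\<^bsub>G\<^esub> a \<otimes>\<^bsub>group_algebra G\<^esub> f) x" .
qed

lemma group_algebra_induct [consumes 1, case_names nonempty single add]:
  fixes f :: "'g \<Rightarrow> 'k::field"
  assumes "f \<in> carrier (group_algebra G)" and ne: "carrier G \<noteq> {}"
    and single: "\<And>g a. g \<in> carrier G \<Longrightarrow> P (single g a)"
    and add: "\<And>f h. f \<in> carrier (group_algebra G) \<Longrightarrow> h \<in> carrier (group_algebra G) \<Longrightarrow>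
      P f \<Longrightarrow> P h \<Longrightarrow> P (f \<oplus>\<^bsub>group_algebra G\<^esub> h)"
  shows "P f"
proof -
  \<comment> \<open>The induction runs over a finite set containing the support, so that clearing f
    at x requires no case distinction on whether f x is zero.\<close>
  have "finite A \<Longrightarrow> A \<subseteq> carrier G \<Longrightarrow> supp f \<subseteq> A \<Longrightarrow> P f" for A f
  proof (induction A arbitrary: f rule: finite_induct)
    case empty
    obtain g where "g \<in> carrier G" using ne by blast
    \<comment> \<open>The zero function counts as a basis element with coefficient 0, so the
      induction rule has no separate case for zero.\<close>
    moreover have "f = single g 0" using empty by (auto simp: supp_def single_def)
    ultimately show ?case using single by simp
  next
    case (insert x A)
    let ?h = "f(x := 0)"
    have h: "supp ?h \<subseteq> A" using insert.prems by (auto simp: supp_def split: if_splits)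
    have "f = single x (f x) \<oplus>\<^bsub>group_algebra G\<^esub> ?h"
      by (auto simp: single_def group_algebra_def)
    moreover have "P ?h" using insert.IH[OF _ h] insert.prems by blast
    moreover have "?h \<in> carrier (group_algebra G)"
      using h insert.hyps insert.prems by (auto simp: group_algebra_def intro: finite_subset)
    ultimately show ?case
      using insert.prems single[of x] add[of "single x (f x)" ?h] by (auto simp: single_closed)
  qed
  then show ?thesis using assms(1) by (auto simp: group_algebra_def)
qed

section \<open>The Hecke relations in the quotient\<close>

lemma monoid_braid_group: "Group.monoid (braid_group n)"
  by (intro group.is_monoid group_braid_group)

lemma hecke_coset_hom:
  "ring_hom_ring (braid_algebra n) (hecke_algebra n q) ((+>\<^bsub>braid_algebra n\<^esub>) (hecke_ideal n q))"
  unfolding hecke_algebra_def by (rule ideal.rcos_ring_hom_ring[OF ideal_hecke_ideal])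

lemma carrier_hecke_algebra:
  "carrier (hecke_algebra n q) =
    (\<lambda>f. hecke_ideal n q +>\<^bsub>braid_algebra n\<^esub> f) ` carrier (braid_algebra n)"
  by (auto simp: hecke_algebra_def FactRing_def A_RCOSETS_def')

lemma zero_hecke_algebra: "\<zero>\<^bsub>hecke_algebra n q\<^esub> = hecke_ideal n q"
  by (simp add: hecke_algebra_def FactRing_def)

lemma single_one_closed: "single \<one>\<^bsub>braid_group n\<^esub> a \<in> carrier (braid_algebra n)"
  by (intro single_closed monoid.one_closed monoid_braid_group)

lemma scalar_ring_hecke: "scalar_ring (hecke_algebra n q) (hecke_scalar n (q::'k::field))"
proof -
  interpret \<pi>: ring_hom_ring "braid_algebra n" "hecke_algebra n q"
    "(+>\<^bsub>braid_algebra n\<^esub>) (hecke_ideal n q)" by (rule hecke_coset_hom)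
  note cl = single_one_closed[of n]
  show ?thesis
  proof unfold_locales
    fix a b :: 'k and x
    show "hecke_scalar n q a \<in> carrier (hecke_algebra n q)"
      unfolding hecke_scalar_def by (rule \<pi>.hom_closed[OF cl])
    show "hecke_scalar n q (a + b) =
        hecke_scalar n q a \<oplus>\<^bsub>hecke_algebra n q\<^esub> hecke_scalar n q b"
      unfolding hecke_scalar_def by (subst \<pi>.hom_add[OF cl cl, symmetric]) (simp add: single_add)
    show "hecke_scalar n q (a * b) =
        hecke_scalar n q a \<otimes>\<^bsub>hecke_algebra n q\<^esub> hecke_scalar n q b"
      unfolding hecke_scalar_def
      by (subst \<pi>.hom_mult[OF cl cl, symmetric])
        (simp add: single_mult monoid.l_one monoid.one_closed monoid_braid_group)
    have "single \<one>\<^bsub>braid_group n\<^esub> (1::'k) = \<one>\<^bsub>braid_algebra n\<^esub>"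
      by (simp add: group_algebra_def)
    then show "hecke_scalar n q 1 = \<one>\<^bsub>hecke_algebra n q\<^esub>"
      unfolding hecke_scalar_def using \<pi>.hom_one by simp
    assume "x \<in> carrier (hecke_algebra n q)"
    then obtain f where f: "f \<in> carrier (braid_algebra n)"
      "x = hecke_ideal n q +>\<^bsub>braid_algebra n\<^esub> f"
      by (auto simp: carrier_hecke_algebra)
    show "x \<otimes>\<^bsub>hecke_algebra n q\<^esub> hecke_scalar n q a =
        hecke_scalar n q a \<otimes>\<^bsub>hecke_algebra n q\<^esub> x"
      unfolding hecke_scalar_def f(2)
      by (simp only: \<pi>.hom_mult[OF cl f(1), symmetric] \<pi>.hom_mult[OF f(1) cl, symmetric]
        single_one_central[OF monoid_braid_group f(1)])
  qed
qed

lemma hecke_gen_closed: "i \<in> {1..<n} \<Longrightarrow> hecke_gen n q i \<in> carrier (hecke_algebra n q)"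
  by (auto simp: carrier_hecke_algebra hecke_gen_def intro!: imageI single_closed braid_gen_closed)

lemma hecke_relator_closed: "i \<in> {1..<n} \<Longrightarrow> hecke_relator n q i \<in> carrier (braid_algebra n)"
proof -
  interpret ring "braid_algebra n :: (braid_word set \<Rightarrow> 'a) ring" by (rule ring_braid_algebra)
  show "i \<in> {1..<n} \<Longrightarrow> hecke_relator n q i \<in> carrier (braid_algebra n)"
    by (simp add: hecke_relator_def single_closed braid_gen_closed)
qed

text \<open>The relator lies in the ideal, so its coset is zero; the projection is a ring
  homomorphism and carries the relator to the difference of the two sides.\<close>

lemma hecke_gen_square:
  fixes q :: "'k::field"
  assumes i: "i \<in> {1..<n}"
  shows "hecke_gen n q i \<otimes>\<^bsub>hecke_algebra n q\<^esub> hecke_gen n q i =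
    hecke_scalar n q (q - inverse q) \<otimes>\<^bsub>hecke_algebra n q\<^esub> hecke_gen n q i
      \<oplus>\<^bsub>hecke_algebra n q\<^esub> \<one>\<^bsub>hecke_algebra n q\<^esub>"
proof -
  let ?A = "braid_algebra n :: (braid_word set \<Rightarrow> 'k) ring" and ?H = "hecke_algebra n q"
  let ?I = "hecke_ideal n q"
  let ?s = "\<lambda>a. single (braid_gen n i) a :: braid_word set \<Rightarrow> 'k"
  interpret A: ring ?A by (rule ring_braid_algebra)
  interpret H: ring ?H by (rule ring_hecke_algebra)
  interpret \<pi>: ring_hom_ring ?A ?H "(+>\<^bsub>?A\<^esub>) ?I" by (rule hecke_coset_hom)
  interpret I: ideal ?I ?A by (rule ideal_hecke_ideal)
  have s: "?s a \<in> carrier ?A" for a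
    using i by (intro single_closed braid_gen_closed)
  have rel: "hecke_relator n q ` {1..<n} \<subseteq> carrier ?A"
    by (auto simp: hecke_relator_closed)
  then have "hecke_relator n q i \<in> ?I"
    using A.genideal_self[OF rel] i by (auto simp: hecke_ideal_def)
  then have "?I +>\<^bsub>?A\<^esub> hecke_relator n q i = \<zero>\<^bsub>?H\<^esub>"
    by (simp only: I.a_rcos_const zero_hecke_algebra)
  moreover have "?I +>\<^bsub>?A\<^esub> hecke_relator n q i = hecke_gen n q i \<otimes>\<^bsub>?H\<^esub> hecke_gen n q i \<ominus>\<^bsub>?H\<^esub>
      ((?I +>\<^bsub>?A\<^esub> ?s (q - inverse q)) \<oplus>\<^bsub>?H\<^esub> \<one>\<^bsub>?H\<^esub>)"
    unfolding hecke_relator_def hecke_gen_def A.minus_eq H.minus_eq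
    by (simp only: \<pi>.hom_add \<pi>.hom_a_inv \<pi>.hom_mult \<pi>.hom_one s A.m_closed A.a_closed A.a_inv_closed A.one_closed)
  ultimately have "hecke_gen n q i \<otimes>\<^bsub>?H\<^esub> hecke_gen n q i \<ominus>\<^bsub>?H\<^esub>
      ((?I +>\<^bsub>?A\<^esub> ?s (q - inverse q)) \<oplus>\<^bsub>?H\<^esub> \<one>\<^bsub>?H\<^esub>) = \<zero>\<^bsub>?H\<^esub>"
    by (simp only:)
  then have "hecke_gen n q i \<otimes>\<^bsub>?H\<^esub> hecke_gen n q i =
      (?I +>\<^bsub>?A\<^esub> ?s (q - inverse q)) \<oplus>\<^bsub>?H\<^esub> \<one>\<^bsub>?H\<^esub>"
    using H.minus_equality[of _ "\<ominus>\<^bsub>?H\<^esub> y" for y] s i hecke_gen_closed[OF i, of q]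
      \<pi>.hom_closed[OF s] H.minus_minus H.a_inv_closed H.a_closed H.one_closed H.m_closed
    unfolding H.minus_eq by metis
  \<comment> \<open>In the relator the coefficient q - 1/q sits on the basis element; it is split
    off as a scalar factor before projecting.\<close>
  also have "?s (q - inverse q) = single \<one>\<^bsub>braid_group n\<^esub> (q - inverse q) \<otimes>\<^bsub>?A\<^esub> ?s 1"
    using i by (simp add: single_mult monoid.l_one[OF monoid_braid_group] braid_gen_closed)
  also have "?I +>\<^bsub>?A\<^esub> \<dots> = hecke_scalar n q (q - inverse q) \<otimes>\<^bsub>?H\<^esub> hecke_gen n q i"
    unfolding hecke_scalar_def hecke_gen_def by (rule \<pi>.hom_mult[OF single_one_closed s])
  finally show ?thesis .
qed

text \<open>Products of generators collapse to the coset of a single word, so the braid and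
  commutation relations in the quotient reduce to equalities of braid classes.\<close>

lemma hecke_gen_mult_coset:
  assumes "i \<in> {1..<n}" "w \<in> braid_words n"
  shows "hecke_gen n q i \<otimes>\<^bsub>hecke_algebra n q\<^esub>
      (hecke_ideal n q +>\<^bsub>braid_algebra n\<^esub> single (braid_class n w) a) =
    hecke_ideal n q +>\<^bsub>braid_algebra n\<^esub> single (braid_class n ((i, True) # w)) a"
proof -
  interpret \<pi>: ring_hom_ring "braid_algebra n" "hecke_algebra n q"
    "(+>\<^bsub>braid_algebra n\<^esub>) (hecke_ideal n q)" by (rule hecke_coset_hom)
  have "single (braid_class n w) a \<in> carrier (braid_algebra n)"
    using assms by (intro single_closed) (simp add: carrier_braid_group)
  moreover have "single (braid_gen n i) 1 \<in> carrier (braid_algebra n)"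
    using assms by (intro single_closed braid_gen_closed)
  moreover have "[(i, True)] \<in> braid_words n"
    using assms by (simp add: braid_words_def)
  ultimately show ?thesis
    unfolding hecke_gen_def
    by (subst \<pi>.hom_mult[symmetric])
      (simp_all add: single_mult braid_gen_def braid_class_mult assms)
qed

lemma hecke_gen_coset:
  "hecke_gen n q i = hecke_ideal n q +>\<^bsub>braid_algebra n\<^esub> single (braid_class n [(i, True)]) 1"
  by (simp add: hecke_gen_def braid_gen_def)

lemma hecke_gen_braid:
  assumes "0 < i" "Suc i < n"
  shows "hecke_gen n q (Suc i) \<otimes>\<^bsub>hecke_algebra n q\<^esub>
      (hecke_gen n q i \<otimes>\<^bsub>hecke_algebra n q\<^esub> hecke_gen n q (Suc i)) =
    hecke_gen n q i \<otimes>\<^bsub>hecke_algebra n q\<^esub>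
      (hecke_gen n q (Suc i) \<otimes>\<^bsub>hecke_algebra n q\<^esub> hecke_gen n q i)"
proof -
  have "braid_eq n [(Suc i, True), (i, True), (Suc i, True)] [(i, True), (Suc i, True), (i, True)]"
    using assms by (intro braid_eq_braid) auto
  then have "braid_class n [(Suc i, True), (i, True), (Suc i, True)] =
      braid_class n [(i, True), (Suc i, True), (i, True)]"
    using braid_class_eq_iff braid_eq_words by blast
  moreover have words: "w \<in> braid_words n" if "set w \<subseteq> {i, Suc i} \<times> UNIV" for w :: braid_word
    using that assms by (force simp: braid_words_def)
  moreover have "hecke_gen n q j \<otimes>\<^bsub>hecke_algebra n q\<^esub>
      (hecke_gen n q k \<otimes>\<^bsub>hecke_algebra n q\<^esub> hecke_gen n q j) =
      hecke_ideal n q +>\<^bsub>braid_algebra n\<^esub> single (braid_class n [(j, True), (k, True), (j, True)]) 1"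
    if "j \<in> {i, Suc i}" "k \<in> {i, Suc i}" for j k
  proof -
    have "j \<in> {1..<n}" "k \<in> {1..<n}" using that assms by auto
    then show ?thesis
      using hecke_gen_mult_coset[of k n "[(j, True)]" q 1]
        hecke_gen_mult_coset[of j n "[(k, True), (j, True)]" q 1] that
      by (simp add: words hecke_gen_coset[symmetric])
  qed
  ultimately show ?thesis by simp
qed

lemma hecke_gen_commute:
  assumes "0 < i" "Suc i < j" "j < n"
  shows "hecke_gen n q i \<otimes>\<^bsub>hecke_algebra n q\<^esub> hecke_gen n q j =
    hecke_gen n q j \<otimes>\<^bsub>hecke_algebra n q\<^esub> hecke_gen n q i"
proof -
  have "braid_eq n [(i, True), (j, True)] [(j, True), (i, True)]"
    using assms by (intro braid_eq_commute) auto
  then have "braid_class n [(i, True), (j, True)] = braid_class n [(j, True), (i, True)]"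
    using braid_class_eq_iff braid_eq_words by blast
  moreover have "[(i, True)] \<in> braid_words n" "[(j, True)] \<in> braid_words n"
    using assms by (auto simp: braid_words_def)
  ultimately show ?thesis
    using assms hecke_gen_mult_coset[of i n "[(j, True)]" q 1]
      hecke_gen_mult_coset[of j n "[(i, True)]" q 1]
    by (simp add: hecke_gen_coset[symmetric])
qed

text \<open>Scaling by q moves the roots q and -1/q of the quadratic relation to q^2 and -1. The
  other relations are homogeneous and survive the scaling.\<close>

lemma hecke_relations_hecke:
  fixes q :: "'k::field"
  assumes q: "q \<noteq> 0"
  shows "hecke_relations (hecke_algebra n q) (hecke_scalar n q) (q ^ 2)
    (\<lambda>i. hecke_scalar n q q \<otimes>\<^bsub>hecke_algebra n q\<^esub> hecke_gen n q i) n"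
proof -
  let ?H = "hecke_algebra n q" and ?c = "hecke_scalar n q" and ?g = "hecke_gen n q"
  interpret scalar_ring ?H ?c by (rule scalar_ring_hecke)
  have g: "0 < i \<Longrightarrow> i < n \<Longrightarrow> ?g i \<in> carrier ?H" for i
    by (rule hecke_gen_closed) simp
  show ?thesis
  proof unfold_locales
    fix i j :: nat
    show "?c q \<otimes>\<^bsub>?H\<^esub> ?g i \<in> carrier ?H" if "0 < i" "i < n"
      using that by (simp add: g)
    show "(?c q \<otimes>\<^bsub>?H\<^esub> ?g i) \<otimes>\<^bsub>?H\<^esub> (?c q \<otimes>\<^bsub>?H\<^esub> ?g i) \<oplus>\<^bsub>?H\<^esub> ?c q \<otimes>\<^bsub>?H\<^esub> ?g i =
        ?c (q ^ 2) \<otimes>\<^bsub>?H\<^esub> (?c q \<otimes>\<^bsub>?H\<^esub> ?g i) \<oplus>\<^bsub>?H\<^esub> ?c (q ^ 2)" if "0 < i" "i < n"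
    proof -
      have gi: "?g i \<in> carrier ?H" using that by (rule g)
      have "(?c q \<otimes>\<^bsub>?H\<^esub> ?g i) \<otimes>\<^bsub>?H\<^esub> (?c q \<otimes>\<^bsub>?H\<^esub> ?g i) =
          ?c (q ^ 2 * (q - inverse q)) \<otimes>\<^bsub>?H\<^esub> ?g i \<oplus>\<^bsub>?H\<^esub> ?c (q ^ 2)"
        using that gi hecke_gen_square[of i n q]
        by (simp add: c_mult_c_mult r_distr c_mult_assoc power2_eq_square)
      moreover have "q ^ 2 * (q - inverse q) + q = q ^ 2 * q"
        using q by (simp add: algebra_simps power2_eq_square)
      then have "?c (q ^ 2 * (q - inverse q)) \<otimes>\<^bsub>?H\<^esub> ?g i \<oplus>\<^bsub>?H\<^esub> ?c q \<otimes>\<^bsub>?H\<^esub> ?g i =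
          ?c (q ^ 2) \<otimes>\<^bsub>?H\<^esub> (?c q \<otimes>\<^bsub>?H\<^esub> ?g i)"
        using gi by (simp only: c_mult_assoc l_distr[symmetric] c_closed c_add[symmetric])
      ultimately show ?thesis
        using gi by (metis (no_types, lifting) a_assoc a_comm c_closed m_closed)
    qed
    show "(?c q \<otimes>\<^bsub>?H\<^esub> ?g (Suc i)) \<otimes>\<^bsub>?H\<^esub> ((?c q \<otimes>\<^bsub>?H\<^esub> ?g i) \<otimes>\<^bsub>?H\<^esub> (?c q \<otimes>\<^bsub>?H\<^esub> ?g (Suc i))) =
        (?c q \<otimes>\<^bsub>?H\<^esub> ?g i) \<otimes>\<^bsub>?H\<^esub> ((?c q \<otimes>\<^bsub>?H\<^esub> ?g (Suc i)) \<otimes>\<^bsub>?H\<^esub> (?c q \<otimes>\<^bsub>?H\<^esub> ?g i))"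
      if "0 < i" "Suc i < n"
      using that by (simp add: c_mult_c_mult g hecke_gen_braid)
    show "(?c q \<otimes>\<^bsub>?H\<^esub> ?g i) \<otimes>\<^bsub>?H\<^esub> (?c q \<otimes>\<^bsub>?H\<^esub> ?g j) =
        (?c q \<otimes>\<^bsub>?H\<^esub> ?g j) \<otimes>\<^bsub>?H\<^esub> (?c q \<otimes>\<^bsub>?H\<^esub> ?g i)"
      if "0 < i" "Suc i < j" "j < n"
      using that hecke_gen_commute[OF that, of q] by (simp add: c_mult_c_mult g)
  qed
qed

text \<open>The multiples of P form a right ideal: letters act on P by q or 1/q, words by products
  of these, and general elements by linear combinations. Taking P to be the candidate N, this makes
  N S a scalar multiple of N for every S.\<close>

lemma hecke_algebra_right_eigen:
  fixes q :: "'k::field"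
  assumes q: "q \<noteq> 0" and P: "P \<in> carrier (hecke_algebra n q)"
    and eig: "\<And>i. i \<in> {1..<n} \<Longrightarrow> P \<otimes>\<^bsub>hecke_algebra n q\<^esub> hecke_gen n q i =
      hecke_scalar n q q \<otimes>\<^bsub>hecke_algebra n q\<^esub> P"
    and h: "h \<in> carrier (hecke_algebra n q)"
  shows "\<exists>a. P \<otimes>\<^bsub>hecke_algebra n q\<^esub> h = hecke_scalar n q a \<otimes>\<^bsub>hecke_algebra n q\<^esub> P"
proof -
  let ?A = "braid_algebra n :: (braid_word set \<Rightarrow> 'k) ring" and ?H = "hecke_algebra n q"
  let ?c = "hecke_scalar n q"
  interpret scalar_ring ?H ?c by (rule scalar_ring_hecke)
  interpret \<pi>: ring_hom_ring ?A ?H "(+>\<^bsub>?A\<^esub>) (hecke_ideal n q)" by (rule hecke_coset_hom)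
  let ?\<pi> = "\<lambda>f. hecke_ideal n q +>\<^bsub>?A\<^esub> f"
  let ?E = "\<lambda>h. \<exists>a. P \<otimes>\<^bsub>?H\<^esub> h = ?c a \<otimes>\<^bsub>?H\<^esub> P"
  have word_closed: "single (braid_class n w) a \<in> carrier ?A" if "w \<in> braid_words n" for w a
    using that by (intro single_closed) (simp add: carrier_braid_group)
  have one: "?\<pi> (single (braid_class n []) a) = ?c a" for a
    by (simp add: hecke_scalar_def one_braid_group)
  have letter: "?E (?\<pi> (single (braid_class n [(i, b)]) 1))" if i: "i \<in> {1..<n}" for i b
  proof (cases b)
    case True
    then show ?thesis using eig[OF i] by (auto simp: hecke_gen_coset[symmetric])
  next
    case False
    let ?g = "hecke_gen n q i" and ?g' = "?\<pi> (single (braid_class n [(i, False)]) 1)"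
    have w: "[(i, False)] \<in> braid_words n" using i by (simp add: braid_words_def)
    have g: "?g \<in> carrier ?H" "?g' \<in> carrier ?H"
      using i word_closed[OF w] by (auto simp: hecke_gen_closed)
    have "braid_class n [(i, True), (i, False)] = braid_class n []"
      using braid_eq_cancel[OF i, of True] braid_class_eq_iff braid_eq_words by fastforce
    then have "?g \<otimes>\<^bsub>?H\<^esub> ?g' = \<one>\<^bsub>?H\<^esub>"
      using hecke_gen_mult_coset[OF i w, of q 1] one[of 1] by (simp add: c_one)
    \<comment> \<open>The inverse letter is handled by inserting the generator and its inverse after
      P: the generator yields q, which is then divided out.\<close>
    then have "P = P \<otimes>\<^bsub>?H\<^esub> (?g \<otimes>\<^bsub>?H\<^esub> ?g')"
      using P by simp
    also have "\<dots> = (P \<otimes>\<^bsub>?H\<^esub> ?g) \<otimes>\<^bsub>?H\<^esub> ?g'"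
      using P g by (simp add: m_assoc)
    also have "\<dots> = ?c q \<otimes>\<^bsub>?H\<^esub> (P \<otimes>\<^bsub>?H\<^esub> ?g')"
      using P g eig[OF i] by (simp add: m_assoc)
    finally have "?c (inverse q) \<otimes>\<^bsub>?H\<^esub> P = ?c (inverse q) \<otimes>\<^bsub>?H\<^esub> (?c q \<otimes>\<^bsub>?H\<^esub> (P \<otimes>\<^bsub>?H\<^esub> ?g'))"
      by simp
    also have "\<dots> = P \<otimes>\<^bsub>?H\<^esub> ?g'"
      using P g q by (simp add: c_mult_assoc c_one)
    finally show ?thesis using False by metis
  qed
  have word: "?E (?\<pi> (single (braid_class n w) a))" if "w \<in> braid_words n" for w a
    using that
  proof (induction w)
    case Nil
    then show ?case using P by (auto simp: one c_central)
  next
    case (Cons x w)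
    obtain i b where x: "x = (i, b)" by (cases x)
    have i: "i \<in> {1..<n}" and w: "w \<in> braid_words n" and xw: "[(i, b)] \<in> braid_words n"
      using Cons.prems by (auto simp: x braid_words_def)
    let ?x = "?\<pi> (single (braid_class n [(i, b)]) 1)" and ?w = "?\<pi> (single (braid_class n w) a)"
    have cl: "?x \<in> carrier ?H" "?w \<in> carrier ?H"
      using word_closed[OF w] word_closed[OF xw] by auto
    obtain a1 a2 where a1: "P \<otimes>\<^bsub>?H\<^esub> ?x = ?c a1 \<otimes>\<^bsub>?H\<^esub> P" and a2: "P \<otimes>\<^bsub>?H\<^esub> ?w = ?c a2 \<otimes>\<^bsub>?H\<^esub> P"
      using letter[OF i] Cons.IH[OF w] by blast
    have "?\<pi> (single (braid_class n (x # w)) a) = ?x \<otimes>\<^bsub>?H\<^esub> ?w"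
      using \<pi>.hom_mult[OF word_closed[OF xw] word_closed[OF w], of 1 a]
      by (simp add: x single_mult braid_class_mult[OF xw w])
    then have "P \<otimes>\<^bsub>?H\<^esub> ?\<pi> (single (braid_class n (x # w)) a) = (P \<otimes>\<^bsub>?H\<^esub> ?x) \<otimes>\<^bsub>?H\<^esub> ?w"
      using P cl by (simp add: m_assoc)
    also have "\<dots> = ?c (a1 * a2) \<otimes>\<^bsub>?H\<^esub> P"
      using P cl by (simp add: a1 a2 m_assoc c_mult_assoc)
    finally show ?case by blast
  qed
  obtain f where f: "f \<in> carrier ?A" "h = ?\<pi> f"
    using h by (auto simp: carrier_hecke_algebra)
  from f(1) have "?E (?\<pi> f)"
  proof (induction f rule: group_algebra_induct)
    case (add f g)
    then show ?case using P by (auto simp: r_distr c_add[symmetric] l_distr[symmetric])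
  qed (auto simp: carrier_braid_group intro!: word braid_words_Nil)
  then show ?thesis using f(2) by simp
qed

section \<open>Descent of the character to the Hecke algebra\<close>

definition hecke_char :: "'k::field \<Rightarrow> (braid_word set \<Rightarrow> 'k) set \<Rightarrow> 'k" where
  "hecke_char q A = augment (class_weight q) (SOME f. f \<in> A)"

text \<open>The character kills each relator, since q^2 - ((q - 1/q) q + 1) = 0. Its kernel is an
  ideal and so contains the Hecke ideal, which makes the character constant on cosets and the choice
  in \<open>hecke_char\<close> harmless.\<close>

lemma hecke_char_coset:
  fixes q :: "'k::field"
  assumes q: "q \<noteq> 0" and f: "f \<in> carrier (braid_algebra n)"
  shows "hecke_char q (hecke_ideal n q +>\<^bsub>braid_algebra n\<^esub> f) = augment (class_weight q) f"
proof -
  let ?A = "braid_algebra n :: (braid_word set \<Rightarrow> 'k) ring" and ?e = "augment (class_weight q)"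
  interpret \<epsilon>: ring_hom_ring ?A type_ring ?e by (rule augment_class_weight_hom[OF q])
  interpret I: ideal "hecke_ideal n q" ?A by (rule ideal_hecke_ideal)
  have "hecke_relator n q i \<in> a_kernel ?A type_ring ?e" if i: "i \<in> {1..<n}" for i
  proof -
    have "[(i, True)] \<in> braid_words n" using i by (simp add: braid_words_def)
    then have w: "class_weight q (braid_gen n i) = q"
      using q by (simp add: braid_gen_def class_weight_class word_weight_def)
    have s: "single (braid_gen n i) a \<in> carrier ?A" for a
      using i by (intro single_closed braid_gen_closed)
    have "?e (hecke_relator n q i) = \<zero>\<^bsub>type_ring\<^esub>"
      using s q by (simp add: hecke_relator_def \<epsilon>.R.minus_eq augment_single w type_ring_minus)
        (simp add: type_ring_def algebra_simps)
    then show ?thesis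
      unfolding a_kernel_def' using hecke_relator_closed[OF i] by blast
  qed
  then have ker: "hecke_ideal n q \<subseteq> a_kernel ?A type_ring ?e"
    unfolding hecke_ideal_def by (intro \<epsilon>.R.genideal_minimal \<epsilon>.kernel_is_ideal image_subsetI)
  have "?e g = ?e f" if g: "g \<in> hecke_ideal n q +>\<^bsub>?A\<^esub> f" for g
  proof -
    obtain h where h: "h \<in> hecke_ideal n q" "g = h \<oplus>\<^bsub>?A\<^esub> f"
      using g unfolding a_r_coset_def' by blast
    have "?e h = \<zero>\<^bsub>type_ring\<^esub>"
      using ker h(1) unfolding a_kernel_def' by blast
    moreover have "?e g = ?e h \<oplus>\<^bsub>type_ring\<^esub> ?e f"
      using \<epsilon>.hom_add[OF I.Icarr[OF h(1)] f] by (simp only: h(2))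
    ultimately show ?thesis by (simp only: type_ring_def ring.simps add_0)
  qed
  moreover have "f \<in> hecke_ideal n q +>\<^bsub>?A\<^esub> f"
    using I.a_rcos_self[OF f] .
  ultimately show ?thesis
    unfolding hecke_char_def by (metis someI)
qed

lemma hecke_char_scalar: "q \<noteq> 0 \<Longrightarrow> hecke_char q (hecke_scalar n q a) = a"
  unfolding hecke_scalar_def
  by (simp add: hecke_char_coset[OF _ single_one_closed] augment_single)
    (simp add: one_braid_group class_weight_class braid_words_Nil word_weight_def)

lemma hecke_char_gen: "q \<noteq> 0 \<Longrightarrow> i \<in> {1..<n} \<Longrightarrow> hecke_char q (hecke_gen n q i) = q"
proof -
  assume "q \<noteq> 0" "i \<in> {1..<n}"
  moreover from this have "[(i, True)] \<in> braid_words n" by (simp add: braid_words_def)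
  ultimately show ?thesis
    unfolding hecke_gen_def
    by (simp add: hecke_char_coset single_closed braid_gen_closed augment_single)
      (simp add: braid_gen_def class_weight_class word_weight_def)
qed

lemma
  fixes q :: "'k::field"
  assumes q: "q \<noteq> 0" and xy: "x \<in> carrier (hecke_algebra n q)" "y \<in> carrier (hecke_algebra n q)"
  shows hecke_char_add: "hecke_char q (x \<oplus>\<^bsub>hecke_algebra n q\<^esub> y) = hecke_char q x + hecke_char q y"
    and hecke_char_mult: "hecke_char q (x \<otimes>\<^bsub>hecke_algebra n q\<^esub> y) = hecke_char q x * hecke_char q y"
proof -
  let ?A = "braid_algebra n :: (braid_word set \<Rightarrow> 'k) ring" and ?H = "hecke_algebra n q"
  let ?e = "augment (class_weight q)" and ?\<pi> = "\<lambda>f. hecke_ideal n q +>\<^bsub>?A\<^esub> f"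
  interpret \<epsilon>: ring_hom_ring ?A type_ring ?e by (rule augment_class_weight_hom[OF q])
  interpret \<pi>: ring_hom_ring ?A ?H "(+>\<^bsub>?A\<^esub>) (hecke_ideal n q)" by (rule hecke_coset_hom)
  obtain f g where fg: "f \<in> carrier ?A" "g \<in> carrier ?A" "x = ?\<pi> f" "y = ?\<pi> g"
    using xy by (auto simp: carrier_hecke_algebra)
  note char = hecke_char_coset[OF q, of _ n]
  have "hecke_char q (?\<pi> (f \<oplus>\<^bsub>?A\<^esub> g)) = ?e f \<oplus>\<^bsub>type_ring\<^esub> ?e g"
    using fg(1,2) by (simp only: char \<epsilon>.R.a_closed \<epsilon>.hom_add)
  then show "hecke_char q (x \<oplus>\<^bsub>?H\<^esub> y) = hecke_char q x + hecke_char q y"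
    using fg(1,2) unfolding fg(3,4) by (simp only: \<pi>.hom_add char) (simp only: type_ring_def ring.simps)
  have "hecke_char q (?\<pi> (f \<otimes>\<^bsub>?A\<^esub> g)) = ?e f \<otimes>\<^bsub>type_ring\<^esub> ?e g"
    using fg(1,2) by (simp only: char \<epsilon>.R.m_closed \<epsilon>.hom_mult)
  then show "hecke_char q (x \<otimes>\<^bsub>?H\<^esub> y) = hecke_char q x * hecke_char q y"
    using fg(1,2) unfolding fg(3,4) by (simp only: \<pi>.hom_mult char) (simp only: type_ring_def monoid.simps)
qed

section \<open>Existence, uniqueness and product formula of the symmetrizer\<close>

theorem mainTheorem5:
  fixes q :: "'k::field" and n :: nat
  assumes "n \<ge> 2" and "q \<noteq> 0" and "\<And>k. 2 \<le> k \<Longrightarrow> k \<le> n \<Longrightarrow> qint q k \<noteq> 0"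
  shows "symmetrizer n q =
      hecke_scalar n q (q powi (- ((int n - 1) * (3 * int n - 4) div 2)) / qfact q n)
        \<otimes>\<^bsub>hecke_algebra n q\<^esub>
      ring_prod_list (hecke_algebra n q)
        (map (\<lambda>j. one_shuffle n q \<ominus>\<^bsub>hecke_algebra n q\<^esub>
                   hecke_scalar n q (q powi (int j - 1) * qint q j)) [0..<n - 1])"
proof -
  let ?H = "hecke_algebra n q" and ?c = "hecke_scalar n q" and ?g = "hecke_gen n q"
  interpret hecke_relations ?H ?c "q ^ 2" "\<lambda>i. ?c q \<otimes>\<^bsub>?H\<^esub> ?g i" n
    by (rule hecke_relations_hecke[OF assms(2)])
  \<comment> \<open>\<open>shuf m\<close> belongs to m + 1 strands, hence the shift by one.\<close>
  define m where "m = n - 1"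
  have n: "n = Suc m" and m: "m < n" using assms(1) by (auto simp: m_def)
  have g [simp]: "?g i \<in> carrier ?H" if "0 < i" "i < n" for i
    using that by (intro hecke_gen_closed) simp
  have "one_shuffle n q = shuf m"
    using finsum_shuf[of ?g q m, OF g refl m] unfolding one_shuffle_def
    by (simp only: n atLeast0LessThan lessThan_Suc_atMost)
  then have P: "ring_prod_list ?H (map (\<lambda>j. one_shuffle n q \<ominus>\<^bsub>?H\<^esub>
      ?c (q powi (int j - 1) * qint q j)) [0..<n - 1]) = shuf_prod m m"
    by (simp add: shuf_prod_def m_def qbracket_square[OF assms(2)])
  define k where "k = q powi (- ((int n - 1) * (3 * int n - 4) div 2)) / qfact q n"
  \<comment> \<open>D is the value of the unnormalised product under the character, and k turns out
    to be its inverse.\<close>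
  define D where "D = (\<Prod>j<m. qbracket (q ^ 2) (Suc m) - qbracket (q ^ 2) j)"
  have "int n - 1 = int m" "3 * int n - 4 = 3 * int m - 1" by (auto simp: n)
  moreover have "qfact q n \<noteq> 0" using assms(3) by (rule qfact_nonzero)
  moreover have "D = q powi (int m * (3 * int m - 1) div 2) * qfact q n"
    using prod_qbracket_diff[OF assms(2), of m] by (simp only: D_def n)
  ultimately have kD: "k * D = 1"
    using assms(2) unfolding k_def by (simp only:) (simp add: power_int_minus)
  define N where "N = ?c k \<otimes>\<^bsub>?H\<^esub> shuf_prod m m"
  have N [simp]: "N \<in> carrier ?H" using m by (auto simp: N_def)
  \<comment> \<open>The candidate N is used in two forms: as a multiple of \<open>full m\<close> it
    is a two-sided eigenvector, as a multiple of \<open>shuf_prod m m\<close> it has a computable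
    normalisation.\<close>
  have N_full: "N = ?c (k * (q ^ 2) ^ (\<Sum>j<m. j)) \<otimes>\<^bsub>?H\<^esub> full m"
    using m by (simp add: N_def shuf_prod_full c_mult_assoc)
  have gN: "?g i \<otimes>\<^bsub>?H\<^esub> N = ?c q \<otimes>\<^bsub>?H\<^esub> N" and Ng: "N \<otimes>\<^bsub>?H\<^esub> ?g i = ?c q \<otimes>\<^bsub>?H\<^esub> N"
    if i: "i \<in> {1..<n}" for i
  proof -
    have i': "0 < i" "i < n" "i \<le> m" using i n by auto
    have gi: "?g i \<in> carrier ?H" using i by (rule hecke_gen_closed)
    have f: "full m \<in> carrier ?H" using m by auto
    \<comment> \<open>\<open>t_full\<close> speaks of q times the generator with eigenvalue q^2; one
      factor q is cancelled.\<close>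
    have "?c q \<otimes>\<^bsub>?H\<^esub> (?g i \<otimes>\<^bsub>?H\<^esub> full m) = ?c q \<otimes>\<^bsub>?H\<^esub> (?c q \<otimes>\<^bsub>?H\<^esub> full m)"
      using t_full[OF m i'(1,3)] gi f by (simp add: m_assoc c_mult_assoc power2_eq_square)
    then have "?g i \<otimes>\<^bsub>?H\<^esub> full m = ?c q \<otimes>\<^bsub>?H\<^esub> full m"
      by (rule c_mult_cancel[OF assms(2) m_closed[OF gi f] m_closed[OF c_closed f]])
    then show "?g i \<otimes>\<^bsub>?H\<^esub> N = ?c q \<otimes>\<^bsub>?H\<^esub> N"
      using gi f by (simp add: N_full c_left_commute[OF gi] c_mult_assoc mult.commute)
    have "?c q \<otimes>\<^bsub>?H\<^esub> (full m \<otimes>\<^bsub>?H\<^esub> ?g i) = ?c q \<otimes>\<^bsub>?H\<^esub> (?c q \<otimes>\<^bsub>?H\<^esub> full m)"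
      using full_t[OF m i'(1,3)] gi f by (simp add: c_left_commute[OF f] c_mult_assoc power2_eq_square)
    then have "full m \<otimes>\<^bsub>?H\<^esub> ?g i = ?c q \<otimes>\<^bsub>?H\<^esub> full m"
      by (rule c_mult_cancel[OF assms(2) m_closed[OF f gi] m_closed[OF c_closed f]])
    then show "N \<otimes>\<^bsub>?H\<^esub> ?g i = ?c q \<otimes>\<^bsub>?H\<^esub> N"
      using gi f by (simp add: N_full m_assoc c_mult_assoc mult.commute)
  qed
  \<comment> \<open>N acts as the identity on every left eigenvector. With S = N this is
    idempotence; for another symmetrizer S it gives N S = S.\<close>
  have NS: "N \<otimes>\<^bsub>?H\<^esub> S = S"
    if S: "S \<in> carrier ?H" and eig: "\<And>i. i \<in> {1..<n} \<Longrightarrow> ?g i \<otimes>\<^bsub>?H\<^esub> S = ?c q \<otimes>\<^bsub>?H\<^esub> S" for S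
  proof -
    have "(?c q \<otimes>\<^bsub>?H\<^esub> ?g i) \<otimes>\<^bsub>?H\<^esub> S = ?c (q ^ 2) \<otimes>\<^bsub>?H\<^esub> S" if "0 < i" "i < n" for i
      using that S eig[of i] by (simp add: m_assoc c_mult_assoc power2_eq_square)
    from shuf_prod_mult_eigen[OF S this m, of m]
    have "shuf_prod m m \<otimes>\<^bsub>?H\<^esub> S = ?c D \<otimes>\<^bsub>?H\<^esub> S" by (simp add: D_def)
    then show ?thesis
      using S m kD by (simp add: N_def m_assoc c_mult_assoc c_one)
  qed
  \<comment> \<open>The character takes the value k D = 1 at N, whereas its value at zero is
    0.\<close>
  have "hecke_char q (shuf_prod m m) = D"
    unfolding D_def
    by (rule character_shuf_prod)
      (use assms(2) m in \<open>simp_all add: hecke_char_add hecke_char_mult hecke_char_scalar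
        hecke_char_gen power2_eq_square\<close>)
  then have "hecke_char q N = 1"
    using m assms(2) kD by (simp add: N_def hecke_char_mult hecke_char_scalar)
  then have N0: "N \<noteq> \<zero>\<^bsub>?H\<^esub>"
    using hecke_char_scalar[OF assms(2), of n 0] by (auto simp: c_0)
  have "is_symmetrizer n q N"
    unfolding is_symmetrizer_def using N0 NS[OF N gN] by (simp add: gN Ng)
  moreover have "S = N" if S: "is_symmetrizer n q S" for S
  proof -
    have Sc: "S \<in> carrier ?H" and S0: "S \<noteq> \<zero>\<^bsub>?H\<^esub>" and SS: "S \<otimes>\<^bsub>?H\<^esub> S = S"
      and "\<And>i. i \<in> {1..<n} \<Longrightarrow> ?g i \<otimes>\<^bsub>?H\<^esub> S = ?c q \<otimes>\<^bsub>?H\<^esub> S"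
      using S by (auto simp: is_symmetrizer_def)
    then have "N \<otimes>\<^bsub>?H\<^esub> S = S" by (intro NS)
    then obtain a where a: "S = ?c a \<otimes>\<^bsub>?H\<^esub> N"
      using hecke_algebra_right_eigen[OF assms(2) N Ng Sc] by auto
    have a0: "a \<noteq> 0" using S0 a by (auto simp: c_0)
    \<comment> \<open>From S = a N and N S = S one gets S S = a S. Idempotence of S turns this into
      a S = S = a N, and a is non-zero because S is.\<close>
    have "?c a \<otimes>\<^bsub>?H\<^esub> S = S \<otimes>\<^bsub>?H\<^esub> S"
      using NS[OF N gN] unfolding a by (simp add: c_mult_c_mult c_mult_assoc)
    then have "?c a \<otimes>\<^bsub>?H\<^esub> S = ?c a \<otimes>\<^bsub>?H\<^esub> N"
      using SS a by (simp only:)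
    then show ?thesis
      by (rule c_mult_cancel[OF a0 Sc N])
  qed
  ultimately have "symmetrizer n q = N"
    unfolding symmetrizer_def by (intro the_equality)
  then show ?thesis
    unfolding P N_def k_def .
qed

end
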